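(* Fix an ellipse (the elliptic billiard) $\frac{x^2}{a^2}+\frac{y^2}{b^2}=1$ with $a>b>0$. For each 3-periodic triangle $T$ of this billiard, let $r$ and $R$ be the inradius and circumradius of $T$, $\rho=r/R$, $d=\sqrt{R(R-2r)}$, and let $I_5'$ be the MacBeath inconic of the excentral triangle $T'$ of $T$; it is an ellipse, with major and minor semiaxis lengths $\mu_5'$ and $\mu_5$. Then, over the family of all 3-periodics of the billiard, $\mu_5'$ and $\mu_5$ are variable (neither is constant), but their ratio $\mu_5'/\mu_5$ is invariant (takes the same value for every 3-periodic of the billiard). Moreover, for every 3-periodic, $$\mu_5'=R,\qquad \mu_5=\sqrt{R^2-d^2},\qquad \frac{\mu_5'}{\mu_5}=\frac{R}{\sqrt{R^2-d^2}}=\frac{1}{\sqrt{2\rho}} .$$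
   Context: A 3-periodic of the elliptic billiard is a (non-degenerate) triangle inscribed in the ellipse such that at each vertex the normal to the ellipse is the internal angle bisector of the triangle, i.e. a closed billiard trajectory with three elastic bounces; these form a one-parameter family. The excentral triangle $T'$ of $T$ has as vertices the three excenters of $T$. An inconic of a triangle is a conic tangent to its three sidelines. The MacBeath inconic of a triangle is its inconic centered at the nine-point center $X_5$; its foci are the orthocenter $X_4$ and the circumcenter $X_3$ of that triangle. For the excentral triangle $T'$, the points $X_5,X_4,X_3$ of $T'$ are respectively the circumcenter $X_3$, the incenter $X_1$ and the Bevan point $X_{40}$ of $T$. *)

theory Defs
  imports "HOL-Analysis.Analysis"
begin

type_synonym triangle = "(real^2) \<times> (real^2) \<times> (real^2)"

definition nondegenerate :: "triangle \<Rightarrow> bool" where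
  "nondegenerate = (\<lambda>(A, B, C). \<not> collinear {A, B, C})"

(* The sum (difference) of the unit vectors along the two sides issuing from A
   directs the internal (external) bisector at A of the triangle A, B, C. *)
definition internal_bisector :: "real^2 \<Rightarrow> real^2 \<Rightarrow> real^2 \<Rightarrow> (real^2) set" where
  "internal_bisector A B C = {A + t *\<^sub>R (sgn (B - A) + sgn (C - A)) | t. True}"

definition external_bisector :: "real^2 \<Rightarrow> real^2 \<Rightarrow> real^2 \<Rightarrow> (real^2) set" where
  "external_bisector A B C = {A + t *\<^sub>R (sgn (B - A) - sgn (C - A)) | t. True}"

definition incenter :: "triangle \<Rightarrow> real^2" where
  "incenter = (\<lambda>(A, B, C). THE P. P \<in> internal_bisector A B C
     \<and> P \<in> internal_bisector B C A \<and> P \<in> internal_bisector C A B)"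

definition inradius :: "triangle \<Rightarrow> real" where
  "inradius = (\<lambda>(A, B, C). infdist (incenter (A, B, C)) (affine hull {B, C}))"

definition circumcenter :: "triangle \<Rightarrow> real^2" where
  "circumcenter = (\<lambda>(A, B, C). THE P. dist P A = dist P B \<and> dist P A = dist P C)"

definition circumradius :: "triangle \<Rightarrow> real" where
  "circumradius = (\<lambda>(A, B, C). dist (circumcenter (A, B, C)) A)"

definition excenter :: "real^2 \<Rightarrow> real^2 \<Rightarrow> real^2 \<Rightarrow> real^2" where
  "excenter A B C = (THE P. P \<in> internal_bisector A B C
     \<and> P \<in> external_bisector B C A \<and> P \<in> external_bisector C A B)"

definition excentral_triangle :: "triangle \<Rightarrow> triangle" where
  "excentral_triangle = (\<lambda>(A, B, C). (excenter A B C, excenter B C A, excenter C A B))"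

(* The nine-point circle is the circumcircle of the medial triangle. *)
definition nine_point_center :: "triangle \<Rightarrow> real^2" where
  "nine_point_center = (\<lambda>(A, B, C). circumcenter (midpoint B C, midpoint C A, midpoint A B))"

definition ellipse :: "real \<Rightarrow> real \<Rightarrow> (real^2) set" where
  "ellipse a b = {P. (P$1)\<^sup>2 / a\<^sup>2 + (P$2)\<^sup>2 / b\<^sup>2 = 1}"

(* Directed by (half) the gradient at P of the left-hand side of the equation of the ellipse. *)
definition normal_line :: "real \<Rightarrow> real \<Rightarrow> real^2 \<Rightarrow> (real^2) set" where
  "normal_line a b P = {P + t *\<^sub>R vector [P$1 / a\<^sup>2, P$2 / b\<^sup>2] | t. True}"

definition three_periodics :: "real \<Rightarrow> real \<Rightarrow> triangle set" where
  "three_periodics a b = {(A, B, C). nondegenerate (A, B, C)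
     \<and> A \<in> ellipse a b \<and> B \<in> ellipse a b \<and> C \<in> ellipse a b
     \<and> normal_line a b A = internal_bisector A B C
     \<and> normal_line a b B = internal_bisector B C A
     \<and> normal_line a b C = internal_bisector C A B}"

definition homog :: "real^2 \<Rightarrow> real^3" where
  "homog P = vector [P$1, P$2, 1]"

definition conic_of :: "real^3^3 \<Rightarrow> (real^2) set" where
  "conic_of Q = {P. homog P \<bullet> (Q *v homog P) = 0}"

(* Invertibility excludes degenerate conics (line pairs, double lines, points). *)
definition conic_matrix :: "real^3^3 \<Rightarrow> bool" where
  "conic_matrix Q \<longleftrightarrow> transpose Q = Q \<and> det Q \<noteq> 0"

(* The tangent line at a point P of the conic is the polar line of P. *)
definition tangent_to_conic :: "(real^2) set \<Rightarrow> real^3^3 \<Rightarrow> bool" where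
  "tangent_to_conic L Q \<longleftrightarrow>
     (\<exists>P \<in> conic_of Q. L = {X. homog X \<bullet> (Q *v homog P) = 0})"

definition inconic :: "triangle \<Rightarrow> (real^2) set \<Rightarrow> bool" where
  "inconic = (\<lambda>(A, B, C) S. \<exists>Q. conic_matrix Q \<and> S = conic_of Q
     \<and> tangent_to_conic (affine hull {B, C}) Q
     \<and> tangent_to_conic (affine hull {C, A}) Q
     \<and> tangent_to_conic (affine hull {A, B}) Q)"

definition centered_at :: "(real^2) set \<Rightarrow> real^2 \<Rightarrow> bool" where
  "centered_at S c \<longleftrightarrow> (\<forall>P \<in> S. 2 *\<^sub>R c - P \<in> S)"

definition macbeath_inconic :: "triangle \<Rightarrow> (real^2) set" where
  "macbeath_inconic T = (THE S. inconic T S \<and> centered_at S (nine_point_center T))"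

(* c is the center; the orthonormal vectors u and v direct the major and minor axes. *)
definition ellipse_with_semiaxes :: "(real^2) set \<Rightarrow> real \<Rightarrow> real \<Rightarrow> bool" where
  "ellipse_with_semiaxes S \<alpha> \<beta> \<longleftrightarrow> 0 < \<beta> \<and> \<beta> \<le> \<alpha> \<and>
     (\<exists>c u v. norm u = 1 \<and> norm v = 1 \<and> u \<bullet> v = 0 \<and>
        S = {P. ((P - c) \<bullet> u)\<^sup>2 / \<alpha>\<^sup>2 + ((P - c) \<bullet> v)\<^sup>2 / \<beta>\<^sup>2 = 1})"

definition is_ellipse :: "(real^2) set \<Rightarrow> bool" where
  "is_ellipse S \<longleftrightarrow> (\<exists>\<alpha> \<beta>. ellipse_with_semiaxes S \<alpha> \<beta>)"

definition major_semiaxis :: "(real^2) set \<Rightarrow> real" where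
  "major_semiaxis S = (THE \<alpha>. \<exists>\<beta>. ellipse_with_semiaxes S \<alpha> \<beta>)"

definition minor_semiaxis :: "(real^2) set \<Rightarrow> real" where
  "minor_semiaxis S = (THE \<beta>. \<exists>\<alpha>. ellipse_with_semiaxes S \<alpha> \<beta>)"

end

theory Submission
  imports Defs
begin

text \<open>
  The nine-point center of the excentral triangle is the circumcenter \<open>O\<close> of \<open>T\<close>, and the sides of
  the excentral triangle pass through the vertices of \<open>T\<close> orthogonally to the lines to the incenter
  \<open>I\<close>. The ellipse centered at \<open>O\<close> with one focus at \<open>I\<close> and major semiaxis \<open>R\<close> has the
  circumcircle as pedal curve with respect to \<open>I\<close>, so it touches these sides. An inconic is
  determined by its center, because tangency to a line is a linear condition on the dual conic.
  Euler's relation \<open>R\<^sup>2 - |OI|\<^sup>2 = 2 r R\<close> then gives the minor semiaxis.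

  For the billiard, let \<open>J\<close> be the Joachimsthal constant of the orbit. In the coordinates
  \<open>(x/a, y/b)\<close> the vertices are pairwise conjugate with respect to a diagonal quadratic form
  depending only on \<open>J\<close>; comparing its inverse with the equation of the unit circle yields a
  quadratic equation for \<open>J\<^sup>2\<close> with a single positive root, and also the sum of the
  cosines of the angles, which is \<open>1 + r/R\<close>. So \<open>r/R\<close> is constant, whereas the two isosceles orbits
  with apex on the major and on the minor axis have different circumradii.
\<close>

section \<open>Centers of a triangle\<close>


text \<open>Centers, inconics and semiaxes are unique descriptions of points, point sets or numbers,
  so much of the geometric work is uniqueness. For the inconic, a central symmetry of a real point
  set has to become a symmetric equation, although a conic may have few real points; the three
  points of contact supply enough of them. For the semiaxes, the lengths have to be read off from
  the set alone.

  The quadratic form comes from squaring Joachimsthal's relation for a chord: in the coordinates of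
  the unit circle one factor cancels and a condition bilinear in the end points remains. All three
  chords share J, so no parametrization of the orbits enters the invariance: the vertices form a
  self-polar triangle, and inverting a 3 by 3 matrix trades relations between pairs of vertices for
  sums over vertices. These sums give the sum of the cosines, because 1 + cos equals
  \<open>2 * J\<^sup>2 / (n \<bullet> n)\<close> with n the \<open>ellipse_normal\<close> at the
  vertex.

  The minor semiaxis varies because the quotient of the semiaxes is constant while R is not.\<close>

definition cross2 :: "real^2 \<Rightarrow> real^2 \<Rightarrow> real" where
  "cross2 u v = u$1 * v$2 - u$2 * v$1"

lemma inner_real2: "(u::real^2) \<bullet> v = u$1 * v$1 + u$2 * v$2"
  by (simp add: inner_vec_def sum_2)

lemma eq_real2_iff: "(u::real^2) = v \<longleftrightarrow> u$1 = v$1 \<and> u$2 = v$2"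
  by (simp add: vec_eq_iff forall_2)

lemma cross2_squared: "(cross2 u v)\<^sup>2 = (u \<bullet> u) * (v \<bullet> v) - (u \<bullet> v)\<^sup>2"
  unfolding cross2_def inner_real2 by algebra

lemma collinear_iff_cross2: "collinear {A, B, C::real^2} \<longleftrightarrow> cross2 (B - A) (C - A) = 0"
proof -
  have "collinear {A, B, C} \<longleftrightarrow> collinear {B, A, C}"
    by (simp add: insert_commute)
  also have "\<dots> \<longleftrightarrow> collinear {0, B - A, C - A}"
    by (simp add: collinear_3)
  also have "\<dots> \<longleftrightarrow> \<bar>(B - A) \<bullet> (C - A)\<bar> = norm (B - A) * norm (C - A)"
    by (simp add: norm_cauchy_schwarz_equal)
  also have "\<dots> \<longleftrightarrow> ((B - A) \<bullet> (C - A))\<^sup>2 = (norm (B - A) * norm (C - A))\<^sup>2"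
    by (metis abs_ge_zero norm_ge_zero mult_nonneg_nonneg power2_abs power2_eq_imp_eq)
  also have "\<dots> \<longleftrightarrow> (cross2 (B - A) (C - A))\<^sup>2 = 0"
    by (auto simp: cross2_squared power_mult_distrib power2_norm_eq_inner)
  finally show ?thesis by simp
qed

lemma nondegenerate_iff_cross2:
  "nondegenerate (A, B, C) \<longleftrightarrow> cross2 (B - A) (C - A) \<noteq> 0"
  by (simp add: nondegenerate_def collinear_iff_cross2)

lemma lines_meet_once:
  fixes v w :: "real^2"
  assumes "P \<in> {A + t *\<^sub>R v | t. True}" "P \<in> {B + t *\<^sub>R w | t. True}"
    and "P' \<in> {A + t *\<^sub>R v | t. True}" "P' \<in> {B + t *\<^sub>R w | t. True}"
    and cross: "cross2 v w \<noteq> 0"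
  shows "P = P'"
proof -
  obtain t t' s s' where *: "P = A + t *\<^sub>R v" "P' = A + t' *\<^sub>R v" "P = B + s *\<^sub>R w" "P' = B + s' *\<^sub>R w"
    using assms by blast
  have "P - P' = (t - t') *\<^sub>R v" using *(1,2) by (simp add: algebra_simps)
  moreover have "P - P' = (s - s') *\<^sub>R w" using *(3,4) by (simp add: algebra_simps)
  ultimately have "(t - t') *\<^sub>R v = (s - s') *\<^sub>R w" by simp
  then have "cross2 ((t - t') *\<^sub>R v) w = cross2 ((s - s') *\<^sub>R w) w" by simp
  then have "(t - t') * cross2 v w = 0" by (simp add: cross2_def algebra_simps)
  then have "t = t'" using cross by simp
  then show ?thesis using * by simp
qed

text \<open>When y and z are side lengths, the direction on the right is a sum of two unit vectors,
  and changing the sign of one weight turns it into a difference. One identity therefore puts the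
  incenter and the excenters on all their bisectors.\<close>

lemma barycentric_eq_from_vertex:
  fixes A B C :: "'a::real_vector"
  assumes "p \<noteq> 0" "y \<noteq> 0" "z \<noteq> 0" "p = x + y + z"
  shows "(1 / p) *\<^sub>R (x *\<^sub>R A + y *\<^sub>R B + z *\<^sub>R C)
    = A + (y * z / p) *\<^sub>R ((1 / z) *\<^sub>R (B - A) + (1 / y) *\<^sub>R (C - A))"
proof -
  have "(y * z / p) *\<^sub>R ((1 / z) *\<^sub>R (B - A) + (1 / y) *\<^sub>R (C - A))
    = (1 / p) *\<^sub>R (y *\<^sub>R (B - A) + z *\<^sub>R (C - A))"
    using assms by (simp add: scaleR_add_right)
  also have "\<dots> = (1 / p) *\<^sub>R (x *\<^sub>R A + y *\<^sub>R B + z *\<^sub>R C - p *\<^sub>R A)"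
    unfolding assms(4) by (rule arg_cong) (simp add: algebra_simps)
  also have "\<dots> = (1 / p) *\<^sub>R (x *\<^sub>R A + y *\<^sub>R B + z *\<^sub>R C) - A"
    using assms(1) by (simp add: scaleR_diff_right)
  finally show ?thesis by simp
qed

section \<open>Incenter and excenters in barycentric coordinates\<close>

locale nondegenerate_triangle =
  fixes A B C :: "real^2"
  assumes nondegenerate: "nondegenerate (A, B, C)"
begin

abbreviation "BC \<equiv> dist B C"
abbreviation "CA \<equiv> dist C A"
abbreviation "AB \<equiv> dist A B"
abbreviation "perimeter \<equiv> BC + CA + AB"
abbreviation "twice_area \<equiv> cross2 (B - A) (C - A)"

lemma twice_area_nonzero: "twice_area \<noteq> 0"
  using nondegenerate by (simp add: nondegenerate_iff_cross2)

text \<open>Interpreting the locale at B, C, A and at C, A, B carries facts about the vertex A over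
  to the other two vertices.\<close>

lemma rotate: "nondegenerate_triangle B C A"
  using nondegenerate by unfold_locales (simp add: nondegenerate_def insert_commute)

lemma sides_pos: "0 < BC" "0 < CA" "0 < AB"
proof -
  have "B \<noteq> C \<and> C \<noteq> A \<and> A \<noteq> B"
    using twice_area_nonzero by (auto simp: cross2_def)
  then show "0 < BC" "0 < CA" "0 < AB" by auto
qed

lemma perimeter_pos: "0 < perimeter"
  using sides_pos by linarith

lemma edge_inner:
  "(B - A) \<bullet> (B - A) = AB\<^sup>2" "(C - A) \<bullet> (C - A) = CA\<^sup>2"
  "(B - A) \<bullet> (C - A) = (CA\<^sup>2 + AB\<^sup>2 - BC\<^sup>2) / 2"
  unfolding dist_norm power2_norm_eq_inner by (simp_all add: algebra_simps inner_commute)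

lemma heron:
  "4 * twice_area\<^sup>2 = perimeter * (CA + AB - BC) * (AB + BC - CA) * (BC + CA - AB)"
  unfolding cross2_squared edge_inner by (simp add: field_simps) algebra

text \<open>The metric gives only weak inequalities; Heron's product is nonzero because the area is,
  and so no factor can vanish.\<close>

lemma strict_triangle: "0 < CA + AB - BC" "0 < AB + BC - CA" "0 < BC + CA - AB"
proof -
  have nz: "perimeter * (CA + AB - BC) * (AB + BC - CA) * (BC + CA - AB) \<noteq> 0"
    using twice_area_nonzero unfolding heron[symmetric] by simp
  have "CA + AB - BC \<ge> 0" "AB + BC - CA \<ge> 0" "BC + CA - AB \<ge> 0"
    using dist_triangle[of B C A] dist_triangle[of C A B] dist_triangle[of A B C]
    by (simp_all add: dist_commute)
  then show "0 < CA + AB - BC" "0 < AB + BC - CA" "0 < BC + CA - AB"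
    using nz by (auto simp: less_le)
qed

lemma sgn_edges:
  "sgn (B - A) = (1 / AB) *\<^sub>R (B - A)" "sgn (C - A) = (1 / CA) *\<^sub>R (C - A)"
  "sgn (C - B) = (1 / BC) *\<^sub>R (C - B)" "sgn (A - B) = (1 / AB) *\<^sub>R (A - B)"
  "sgn (A - C) = (1 / CA) *\<^sub>R (A - C)" "sgn (B - C) = (1 / BC) *\<^sub>R (B - C)"
  by (simp_all add: sgn_div_norm dist_norm norm_minus_commute divide_inverse)

definition "incenter_pt = (1 / perimeter) *\<^sub>R (BC *\<^sub>R A + CA *\<^sub>R B + AB *\<^sub>R C)"

definition "excenter_pt = (1 / (CA + AB - BC)) *\<^sub>R (CA *\<^sub>R B + AB *\<^sub>R C - BC *\<^sub>R A)"

lemma incenter_pt_on_bisector: "incenter_pt \<in> internal_bisector A B C"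
  unfolding internal_bisector_def sgn_edges incenter_pt_def
  using barycentric_eq_from_vertex[of perimeter CA AB BC A B C] sides_pos perimeter_pos by auto

lemma excenter_pt_on_bisectors:
  "excenter_pt \<in> internal_bisector A B C" "excenter_pt \<in> external_bisector B C A"
  "excenter_pt \<in> external_bisector C A B"
proof -
  define p where "p = CA + AB - BC"
  have p: "p \<noteq> 0" using strict_triangle unfolding p_def by linarith
  have nz: "BC \<noteq> 0" "CA \<noteq> 0" "AB \<noteq> 0" using sides_pos by auto
  have A: "excenter_pt = (1 / p) *\<^sub>R ((- BC) *\<^sub>R A + CA *\<^sub>R B + AB *\<^sub>R C)"
    and B: "excenter_pt = (1 / p) *\<^sub>R (CA *\<^sub>R B + AB *\<^sub>R C + (- BC) *\<^sub>R A)"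
    and C: "excenter_pt = (1 / p) *\<^sub>R (AB *\<^sub>R C + (- BC) *\<^sub>R A + CA *\<^sub>R B)"
    unfolding excenter_pt_def p_def by (simp_all add: algebra_simps)
  have "excenter_pt = A + (CA * AB / p) *\<^sub>R (sgn (B - A) + sgn (C - A))"
    unfolding A sgn_edges by (rule barycentric_eq_from_vertex) (use p nz p_def in auto)
  then show "excenter_pt \<in> internal_bisector A B C" unfolding internal_bisector_def by blast
  have "excenter_pt = B + (AB * (- BC) / p) *\<^sub>R ((1 / (- BC)) *\<^sub>R (C - B) + (1 / AB) *\<^sub>R (A - B))"
    unfolding B by (rule barycentric_eq_from_vertex) (use p nz p_def in auto)
  also have "\<dots> = B + (AB * BC / p) *\<^sub>R (sgn (C - B) - sgn (A - B))"
    unfolding sgn_edges by (simp add: algebra_simps)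
  finally show "excenter_pt \<in> external_bisector B C A" unfolding external_bisector_def by blast
  have "excenter_pt = C + ((- BC) * CA / p) *\<^sub>R ((1 / CA) *\<^sub>R (A - C) + (1 / (- BC)) *\<^sub>R (B - C))"
    unfolding C by (rule barycentric_eq_from_vertex) (use p nz p_def in auto)
  also have "\<dots> = C + (- (BC * CA / p)) *\<^sub>R (sgn (A - C) - sgn (B - C))"
    unfolding sgn_edges by (simp add: algebra_simps)
  finally show "excenter_pt \<in> external_bisector C A B" unfolding external_bisector_def by blast
qed

text \<open>Both values are nonzero, so these pairs of bisectors are not parallel. This is the
  uniqueness behind \<open>THE\<close> in \<open>incenter\<close> and
  \<open>excenter\<close>.\<close>

lemma cross2_bisectors:
  "cross2 (sgn (B - A) + sgn (C - A)) (sgn (C - B) + sgn (A - B)) = twice_area * perimeter / (BC * CA * AB)"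
  "cross2 (sgn (B - A) + sgn (C - A)) (sgn (C - B) - sgn (A - B))
     = twice_area * (CA + AB - BC) / (BC * CA * AB)"
  unfolding sgn_edges cross2_def using sides_pos by (simp_all add: field_simps)

end

lemma (in nondegenerate_triangle) incenter_pt_rotate:
  "nondegenerate_triangle.incenter_pt B C A = incenter_pt"
proof -
  interpret BCA: nondegenerate_triangle B C A by (rule rotate)
  show ?thesis unfolding BCA.incenter_pt_def incenter_pt_def by (simp add: algebra_simps)
qed

lemma (in nondegenerate_triangle) incenter_eq: "incenter (A, B, C) = incenter_pt"
proof -
  interpret BCA: nondegenerate_triangle B C A by (rule rotate)
  interpret CAB: nondegenerate_triangle C A B by (rule BCA.rotate)
  note on = incenter_pt_on_bisector BCA.incenter_pt_on_bisector CAB.incenter_pt_on_bisector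
  note on = on[unfolded BCA.incenter_pt_rotate incenter_pt_rotate]
  show ?thesis unfolding incenter_def prod.case
  proof (rule the_equality)
    show "incenter_pt \<in> internal_bisector A B C \<and> incenter_pt \<in> internal_bisector B C A
      \<and> incenter_pt \<in> internal_bisector C A B"
      using on by simp
  next
    fix P assume "P \<in> internal_bisector A B C \<and> P \<in> internal_bisector B C A
      \<and> P \<in> internal_bisector C A B"
    moreover have "cross2 (sgn (B - A) + sgn (C - A)) (sgn (C - B) + sgn (A - B)) \<noteq> 0"
      unfolding cross2_bisectors using twice_area_nonzero sides_pos perimeter_pos by simp
    ultimately show "P = incenter_pt"
      using on lines_meet_once[of P A "sgn (B - A) + sgn (C - A)" B "sgn (C - B) + sgn (A - B)" incenter_pt]
      by (simp add: internal_bisector_def)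
  qed
qed

lemma (in nondegenerate_triangle) excenter_eq: "excenter A B C = excenter_pt"
  unfolding excenter_def
proof (rule the_equality)
  show "excenter_pt \<in> internal_bisector A B C \<and> excenter_pt \<in> external_bisector B C A
      \<and> excenter_pt \<in> external_bisector C A B"
    using excenter_pt_on_bisectors by simp
next
  fix P assume "P \<in> internal_bisector A B C \<and> P \<in> external_bisector B C A
      \<and> P \<in> external_bisector C A B"
  moreover have "cross2 (sgn (B - A) + sgn (C - A)) (sgn (C - B) - sgn (A - B)) \<noteq> 0"
    unfolding cross2_bisectors using twice_area_nonzero sides_pos strict_triangle by simp
  ultimately show "P = excenter_pt"
    using excenter_pt_on_bisectors
      lines_meet_once[of P A "sgn (B - A) + sgn (C - A)" B "sgn (C - B) - sgn (A - B)" excenter_pt]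
    by (simp add: internal_bisector_def external_bisector_def)
qed


section \<open>Lines, distance to a line, equidistance\<close>

lemma affine_hull_2_cross2:
  fixes P Q :: "real^2"
  assumes "P \<noteq> Q"
  shows "affine hull {P, Q} = {X. cross2 (Q - P) (X - P) = 0}"
proof -
  have nz: "(Q - P) \<bullet> (Q - P) \<noteq> 0" using assms by simp
  have "X = P + (((X - P) \<bullet> (Q - P)) / ((Q - P) \<bullet> (Q - P))) *\<^sub>R (Q - P)"
    if "cross2 (Q - P) (X - P) = 0" for X
  proof -
    have "((Q - P) \<bullet> (Q - P)) *\<^sub>R (X - P) = ((X - P) \<bullet> (Q - P)) *\<^sub>R (Q - P)"
      using that unfolding cross2_def eq_real2_iff inner_real2
      by (simp, intro conjI; algebra)
    then have "X - P = (((X - P) \<bullet> (Q - P)) / ((Q - P) \<bullet> (Q - P))) *\<^sub>R (Q - P)"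
      using nz by (metis (no_types, lifting) divide_inverse_commute scaleR_one scaleR_scaleR left_inverse)
    then show ?thesis by (simp add: algebra_simps)
  qed
  moreover have "cross2 (Q - P) (P + u *\<^sub>R (Q - P) - P) = 0" for u
    by (simp add: cross2_def algebra_simps)
  ultimately show ?thesis unfolding affine_hull_2_alt by blast
qed

lemma affine_hull_2_normal:
  fixes P Q n :: "real^2"
  assumes "P \<noteq> Q" "n \<noteq> 0" "n \<bullet> (P - A) = 0" "n \<bullet> (Q - A) = 0"
  shows "affine hull {P, Q} = {X. n \<bullet> (X - A) = 0}"
proof -
  have nn: "n \<bullet> n \<noteq> 0" using assms(2) by simp
  have "n \<bullet> (X - A) = 0" if "cross2 (Q - P) (X - P) = 0" for X
  proof -
    have "((Q - P) \<bullet> (Q - P)) * (n \<bullet> (X - P)) = ((X - P) \<bullet> (Q - P)) * (n \<bullet> (Q - P))"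
      using that unfolding cross2_def inner_real2 by simp algebra
    moreover have "n \<bullet> (Q - P) = 0" using assms(3,4) by (simp add: algebra_simps)
    moreover have "(Q - P) \<bullet> (Q - P) \<noteq> 0" using assms(1) by simp
    ultimately have "n \<bullet> (X - P) = 0" by simp
    then show ?thesis using assms(3) by (simp add: algebra_simps)
  qed
  moreover have "cross2 (Q - P) (X - P) = 0" if "n \<bullet> (X - A) = 0" for X
  proof -
    have "n \<bullet> (X - P) = 0" "n \<bullet> (Q - P) = 0"
      using that assms(3,4) by (simp_all add: algebra_simps)
    then have "(n \<bullet> n) * cross2 (Q - P) (X - P) = 0"
      unfolding cross2_def inner_real2 by simp algebra
    then show ?thesis using nn by simp
  qed
  ultimately show ?thesis unfolding affine_hull_2_cross2[OF assms(1)] by blast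
qed

lemma infdist_line:
  fixes P Q S :: "real^2"
  assumes "Q \<noteq> S"
  shows "infdist P (affine hull {Q, S}) = \<bar>cross2 (S - Q) (P - Q)\<bar> / dist Q S"
proof -
  let ?L = "affine hull {Q, S}"
  have d: "dist Q S > 0" using assms by simp
  have dd: "(dist Q S)\<^sup>2 = (S - Q) \<bullet> (S - Q)"
    by (metis dist_commute dist_norm power2_norm_eq_inner)
  \<comment> \<open>Foot of the perpendicular from \<open>P\<close>. Lagrange's identity
    \<open>cross2_squared\<close> gives the lower bound at every point of the line, and equality at
    \<open>F\<close> because the inner product drops out there.\<close>
  define F where "F = Q + (((P - Q) \<bullet> (S - Q)) / (dist Q S)\<^sup>2) *\<^sub>R (S - Q)"
  have F: "F \<in> ?L" unfolding affine_hull_2_alt F_def by blast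
  have lower: "\<bar>cross2 (S - Q) (P - Q)\<bar> / dist Q S \<le> dist P X" if X: "X \<in> ?L" for X
  proof -
    have "cross2 (S - Q) (P - Q) = cross2 (S - Q) (P - X)"
      using X unfolding affine_hull_2_cross2[OF assms] by (simp add: cross2_def algebra_simps)
    moreover have "(cross2 (S - Q) (P - X))\<^sup>2 \<le> (dist Q S)\<^sup>2 * (dist P X)\<^sup>2"
      unfolding cross2_squared dd by (simp add: dist_norm power2_norm_eq_inner)
    ultimately have "(cross2 (S - Q) (P - Q))\<^sup>2 \<le> (dist Q S)\<^sup>2 * (dist P X)\<^sup>2" by simp
    then have "\<bar>cross2 (S - Q) (P - Q)\<bar> \<le> dist Q S * dist P X"
      using abs_le_square_iff[of "cross2 (S - Q) (P - Q)" "dist Q S * dist P X"]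
      by (simp add: power_mult_distrib abs_mult)
    then show ?thesis using d by (simp add: field_simps)
  qed
  have orth: "(S - Q) \<bullet> (P - F) = 0"
  proof -
    have "P - F = (P - Q) - (((P - Q) \<bullet> (S - Q)) / (dist Q S)\<^sup>2) *\<^sub>R (S - Q)"
      unfolding F_def by simp
    then show ?thesis
      using d by (simp only: inner_diff_right[of _ "P - Q"] inner_scaleR_right dd[symmetric]
        inner_commute[of "P - Q"]) simp
  qed
  have "cross2 (S - Q) (P - Q) = cross2 (S - Q) (P - F)"
    using F unfolding affine_hull_2_cross2[OF assms] by (simp add: cross2_def algebra_simps)
  moreover have "(cross2 (S - Q) (P - F))\<^sup>2 = (dist Q S * dist P F)\<^sup>2"
    unfolding power_mult_distrib dd cross2_squared orth by (simp add: dist_norm power2_norm_eq_inner)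
  ultimately have "(cross2 (S - Q) (P - Q))\<^sup>2 = (dist Q S * dist P F)\<^sup>2" by simp
  then have "\<bar>cross2 (S - Q) (P - Q)\<bar> = dist Q S * dist P F"
    using power2_eq_iff_nonneg[of "\<bar>cross2 (S - Q) (P - Q)\<bar>" "dist Q S * dist P F"] by simp
  then have att: "dist P F = \<bar>cross2 (S - Q) (P - Q)\<bar> / dist Q S"
    using d by (simp add: field_simps)
  show ?thesis
  proof (rule antisym)
    show "infdist P ?L \<le> \<bar>cross2 (S - Q) (P - Q)\<bar> / dist Q S"
      using infdist_le[OF F, of P] att by simp
    have ne: "?L \<noteq> {}" using F by auto
    show "\<bar>cross2 (S - Q) (P - Q)\<bar> / dist Q S \<le> infdist P ?L"
      unfolding infdist_notempty[OF ne] using ne lower by (intro cINF_greatest) auto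
  qed
qed

lemma scaleR_divide_diff: "s \<noteq> 0 \<Longrightarrow> (1 / s) *\<^sub>R X - A = (1 / s) *\<^sub>R (X - s *\<^sub>R A)"
  for X :: "'a::real_vector"
  by (simp add: scaleR_diff_right)

text \<open>The quadratic terms in \<open>P\<close> cancel, so the circumcenter solves a linear
  system whose determinant is a multiple of \<open>twice_area\<close>.\<close>

lemma dist_eq_iff_inner:
  "dist P A = dist P B \<longleftrightarrow> 2 * ((P - A) \<bullet> (B - A)) = (B - A) \<bullet> (B - A)"
  for P :: "'a::real_inner"
proof -
  have "dist P A = dist P B \<longleftrightarrow> (dist P A)\<^sup>2 = (dist P B)\<^sup>2" by simp
  then show ?thesis unfolding dist_norm power2_norm_eq_inner
    by (simp add: algebra_simps inner_commute)
qed

section \<open>Circumcircle, Euler's relation and the excentral triangle\<close>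

context nondegenerate_triangle
begin

lemma ex1_equidistant: "\<exists>!P. dist P A = dist P B \<and> dist P A = dist P C"
proof -
  let ?U = "B - A" and ?V = "C - A" and ?D = "twice_area"
  have eq: "dist P A = dist P B \<and> dist P A = dist P C \<longleftrightarrow>
    2 * ((P - A) \<bullet> ?U) = ?U \<bullet> ?U \<and> 2 * ((P - A) \<bullet> ?V) = ?V \<bullet> ?V" for P
    by (simp add: dist_eq_iff_inner)
  \<comment> \<open>Cramer's rule for the two linear equations, with \<open>W\<close> the
    circumcenter relative to \<open>A\<close>.\<close>
  define W :: "real^2" where "W = vector [(?U \<bullet> ?U * ?V$2 - ?V \<bullet> ?V * ?U$2) / (2 * ?D),
      (?V \<bullet> ?V * ?U$1 - ?U \<bullet> ?U * ?V$1) / (2 * ?D)]"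
  have W: "2 * ?D * W$1 = ?U \<bullet> ?U * ?V$2 - ?V \<bullet> ?V * ?U$2"
    "2 * ?D * W$2 = ?V \<bullet> ?V * ?U$1 - ?U \<bullet> ?U * ?V$1"
    unfolding W_def using twice_area_nonzero by simp_all
  have "?D * (2 * (W \<bullet> ?U)) = ?D * (?U \<bullet> ?U)" "?D * (2 * (W \<bullet> ?V)) = ?D * (?V \<bullet> ?V)"
    using W unfolding inner_real2[of W] cross2_def by algebra+
  then have "2 * (W \<bullet> ?U) = ?U \<bullet> ?U" "2 * (W \<bullet> ?V) = ?V \<bullet> ?V"
    using twice_area_nonzero by simp_all
  then have "2 * ((A + W - A) \<bullet> ?U) = ?U \<bullet> ?U \<and> 2 * ((A + W - A) \<bullet> ?V) = ?V \<bullet> ?V" by simp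
  moreover have "P = Q" if "2 * ((P - A) \<bullet> ?U) = ?U \<bullet> ?U \<and> 2 * ((P - A) \<bullet> ?V) = ?V \<bullet> ?V"
    "2 * ((Q - A) \<bullet> ?U) = ?U \<bullet> ?U \<and> 2 * ((Q - A) \<bullet> ?V) = ?V \<bullet> ?V" for P Q
  proof -
    have 0: "(P - Q) \<bullet> ?U = 0" "(P - Q) \<bullet> ?V = 0" using that by (simp_all add: inner_diff_left)
    have "?D * (P - Q)$1 = 0" "?D * (P - Q)$2 = 0"
      using 0 unfolding cross2_def inner_real2 by algebra+
    then show ?thesis using twice_area_nonzero by (simp add: eq_real2_iff)
  qed
  ultimately show ?thesis unfolding eq by blast
qed

abbreviation "ccenter \<equiv> circumcenter (A, B, C)"
abbreviation "cradius \<equiv> circumradius (A, B, C)"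

lemma circumcenter_eqI:
  "dist P A = dist P B \<Longrightarrow> dist P A = dist P C \<Longrightarrow> circumcenter (A, B, C) = P"
  unfolding circumcenter_def using ex1_equidistant by auto

lemma dist_circumcenter: "dist ccenter A = cradius" "dist ccenter B = cradius" "dist ccenter C = cradius"
  using theI'[OF ex1_equidistant] unfolding circumradius_def circumcenter_def by auto

lemma circumcenter_rotate: "circumcenter (B, C, A) = ccenter"
proof -
  interpret BCA: nondegenerate_triangle B C A by (rule rotate)
  show ?thesis by (rule BCA.circumcenter_eqI) (simp_all add: dist_circumcenter)
qed

lemma circumradius_rotate: "circumradius (B, C, A) = cradius"
  using dist_circumcenter by (simp add: circumradius_def circumcenter_rotate)

lemma circumcenter_inner: "2 * ((ccenter - A) \<bullet> (B - A)) = AB\<^sup>2" "2 * ((ccenter - A) \<bullet> (C - A)) = CA\<^sup>2"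
  using dist_circumcenter dist_eq_iff_inner[of ccenter A B] dist_eq_iff_inner[of ccenter A C] edge_inner by auto

lemma circumradius_eq: "cradius = BC * CA * AB / (2 * \<bar>twice_area\<bar>)"
proof -
  have RR: "cradius\<^sup>2 = (ccenter - A) \<bullet> (ccenter - A)"
    unfolding dist_circumcenter(1)[symmetric] dist_norm power2_norm_eq_inner ..
  \<comment> \<open>The Gram determinant of three vectors of the plane vanishes; here they are
    \<open>ccenter - A\<close> and the two edges from \<open>A\<close>.\<close>
  have "twice_area\<^sup>2 * cradius\<^sup>2 = ((ccenter - A) \<bullet> (C - A))\<^sup>2 * ((B - A) \<bullet> (B - A))
     + ((ccenter - A) \<bullet> (B - A))\<^sup>2 * ((C - A) \<bullet> (C - A))
     - 2 * ((ccenter - A) \<bullet> (B - A)) * ((ccenter - A) \<bullet> (C - A)) * ((B - A) \<bullet> (C - A))"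
    unfolding RR cross2_def inner_real2 by algebra
  then have "4 * (twice_area\<^sup>2 * cradius\<^sup>2) = (2 * ((ccenter - A) \<bullet> (C - A)))\<^sup>2 * AB\<^sup>2
     + (2 * ((ccenter - A) \<bullet> (B - A)))\<^sup>2 * CA\<^sup>2
     - (2 * ((ccenter - A) \<bullet> (B - A))) * (2 * ((ccenter - A) \<bullet> (C - A))) * (CA\<^sup>2 + AB\<^sup>2 - BC\<^sup>2)"
    unfolding edge_inner by (simp add: power2_eq_square field_simps)
  also have "\<dots> = (BC * CA * AB)\<^sup>2" unfolding circumcenter_inner by algebra
  finally have "(2 * \<bar>twice_area\<bar> * cradius)\<^sup>2 = (BC * CA * AB)\<^sup>2" by (simp add: power_mult_distrib)
  then have "2 * \<bar>twice_area\<bar> * cradius = BC * CA * AB"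
    by (rule power2_eq_imp_eq) (simp_all flip: dist_circumcenter(1))
  then show ?thesis using twice_area_nonzero by (simp add: field_simps)
qed

lemma circumradius_pos: "0 < cradius"
  unfolding circumradius_eq using sides_pos twice_area_nonzero by simp

lemma incenter_minus_vertex:
  "incenter_pt - A = (1 / perimeter) *\<^sub>R (CA *\<^sub>R (B - A) + AB *\<^sub>R (C - A))"
proof -
  have "incenter_pt - A = (1 / perimeter) *\<^sub>R (BC *\<^sub>R A + CA *\<^sub>R B + AB *\<^sub>R C - perimeter *\<^sub>R A)"
    unfolding incenter_pt_def using perimeter_pos by (intro scaleR_divide_diff) simp
  also have "\<dots> = (1 / perimeter) *\<^sub>R (CA *\<^sub>R (B - A) + AB *\<^sub>R (C - A))"
    by (rule arg_cong) (simp add: algebra_simps)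
  finally show ?thesis .
qed

text \<open>Expanding the distance about \<open>A\<close> involves the circumcenter only through its
  known inner products with the two edges. The quotient on the right is 2 r R by
  \<open>two_inradius_circumradius\<close>, which makes this Euler's relation.\<close>

lemma euler_power: "(dist incenter_pt ccenter)\<^sup>2 = cradius\<^sup>2 - BC * CA * AB / perimeter"
proof -
  let ?U = "B - A" and ?V = "C - A" and ?W = "CA *\<^sub>R (B - A) + AB *\<^sub>R (C - A)"
  define p where "p = perimeter"
  have p: "p > 0" "p = perimeter" unfolding p_def using perimeter_pos by auto
  have RR: "cradius\<^sup>2 = (ccenter - A) \<bullet> (ccenter - A)"
    unfolding dist_circumcenter(1)[symmetric] dist_norm power2_norm_eq_inner ..
  have WW: "?W \<bullet> ?W = CA * AB * p * (CA + AB - BC)"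
    unfolding inner_add_left inner_add_right inner_scaleR_left inner_scaleR_right
      edge_inner inner_commute[of ?V ?U] p(2) by (simp add: field_simps) algebra
  have "2 * (?W \<bullet> (ccenter - A))
      = CA * (2 * ((ccenter - A) \<bullet> ?U)) + AB * (2 * ((ccenter - A) \<bullet> ?V))"
    by (simp only: inner_add_left inner_scaleR_left inner_commute[of ?U] inner_commute[of ?V] distrib_left mult.left_commute)
  then have WO: "2 * (?W \<bullet> (ccenter - A)) = CA * AB * (CA + AB)"
    unfolding circumcenter_inner by (simp add: power2_eq_square algebra_simps)
  have "incenter_pt - ccenter = (incenter_pt - A) - (ccenter - A)" by simp
  moreover have "(x - y) \<bullet> (x - y) = x \<bullet> x - 2 * (x \<bullet> y) + y \<bullet> y" for x y :: "real^2"
    by (simp add: algebra_simps inner_commute)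
  ultimately have "(dist incenter_pt ccenter)\<^sup>2 = (incenter_pt - A) \<bullet> (incenter_pt - A)
      - 2 * ((incenter_pt - A) \<bullet> (ccenter - A)) + cradius\<^sup>2"
    unfolding RR dist_norm power2_norm_eq_inner by metis
  also have "(incenter_pt - A) \<bullet> (incenter_pt - A) = (1 / p)\<^sup>2 * (?W \<bullet> ?W)"
    unfolding incenter_minus_vertex p(2)[symmetric] by (simp only: inner_scaleR_left inner_scaleR_right power2_eq_square mult.assoc)
  also have "2 * ((incenter_pt - A) \<bullet> (ccenter - A)) = (1 / p) * (2 * (?W \<bullet> (ccenter - A)))"
    unfolding incenter_minus_vertex p(2)[symmetric] by (simp only: inner_scaleR_left mult.left_commute)
  also have "(1 / p)\<^sup>2 * (?W \<bullet> ?W) - (1 / p) * (2 * (?W \<bullet> (ccenter - A))) + cradius\<^sup>2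
      = cradius\<^sup>2 - BC * CA * AB / p"
    unfolding WW WO using p(1) by (simp add: power2_eq_square field_simps)
  finally show ?thesis unfolding p(2) .
qed

lemma inradius_eq: "inradius (A, B, C) = \<bar>twice_area\<bar> / perimeter"
proof -
  define p where "p = perimeter"
  have p: "p > 0" "p = perimeter" unfolding p_def using perimeter_pos by auto
  \<comment> \<open>The weight of \<open>A\<close> in the incenter is \<open>BC / p\<close>, so the
    triangle spanned by the incenter and the side \<open>BC\<close> has this share of the
    area.\<close>
  have "p * cross2 (C - B) (incenter_pt - B) = BC * twice_area"
    unfolding cross2_def incenter_pt_def p(2)[symmetric] using p(1)
    by (simp add: field_simps) (simp add: p(2) algebra_simps)
  then have "cross2 (C - B) (incenter_pt - B) = BC * twice_area / p" using p(1) by (simp add: field_simps)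
  then show ?thesis unfolding inradius_def prod.case incenter_eq
    using infdist_line[of B C incenter_pt] sides_pos p by (simp add: abs_mult)
qed

lemma inradius_pos: "0 < inradius (A, B, C)"
  unfolding inradius_eq using twice_area_nonzero perimeter_pos by simp

lemma two_inradius_circumradius: "2 * inradius (A, B, C) * cradius = BC * CA * AB / perimeter"
  unfolding inradius_eq circumradius_eq using twice_area_nonzero by simp

text \<open>Seen from \<open>A\<close>, the excenters opposite to \<open>B\<close> and
  \<open>C\<close> lie in opposite directions on the external bisector. Hence \<open>A\<close> lies
  on a side of the excentral triangle.\<close>

lemma excenter_pt_minus_vertex:
  "excenter_pt - A = (1 / (CA + AB - BC)) *\<^sub>R (CA *\<^sub>R (B - A) + AB *\<^sub>R (C - A))"
  "nondegenerate_triangle.excenter_pt B C A - A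
     = (1 / (AB + BC - CA)) *\<^sub>R (AB *\<^sub>R (C - A) - CA *\<^sub>R (B - A))"
  "nondegenerate_triangle.excenter_pt C A B - A
     = (1 / (BC + CA - AB)) *\<^sub>R (CA *\<^sub>R (B - A) - AB *\<^sub>R (C - A))"
proof -
  interpret BCA: nondegenerate_triangle B C A by (rule rotate)
  interpret CAB: nondegenerate_triangle C A B by (rule BCA.rotate)
  define x y z where "x = CA + AB - BC" and "y = AB + BC - CA" and "z = BC + CA - AB"
  have nz: "x \<noteq> 0" "y \<noteq> 0" "z \<noteq> 0" using strict_triangle unfolding x_def y_def z_def by linarith+
  have "excenter_pt - A = (1 / x) *\<^sub>R (CA *\<^sub>R B + AB *\<^sub>R C - BC *\<^sub>R A - x *\<^sub>R A)"
    unfolding excenter_pt_def x_def[symmetric] by (rule scaleR_divide_diff[OF nz(1)])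
  also have "\<dots> = (1 / x) *\<^sub>R (CA *\<^sub>R (B - A) + AB *\<^sub>R (C - A))"
    by (rule arg_cong) (simp add: x_def algebra_simps)
  finally show "excenter_pt - A = (1 / (CA + AB - BC)) *\<^sub>R (CA *\<^sub>R (B - A) + AB *\<^sub>R (C - A))"
    unfolding x_def .
  have "BCA.excenter_pt - A = (1 / y) *\<^sub>R (AB *\<^sub>R C + BC *\<^sub>R A - CA *\<^sub>R B - y *\<^sub>R A)"
    unfolding BCA.excenter_pt_def y_def[symmetric] by (rule scaleR_divide_diff[OF nz(2)])
  also have "\<dots> = (1 / y) *\<^sub>R (AB *\<^sub>R (C - A) - CA *\<^sub>R (B - A))"
    by (rule arg_cong) (simp add: y_def algebra_simps)
  finally show "BCA.excenter_pt - A = (1 / (AB + BC - CA)) *\<^sub>R (AB *\<^sub>R (C - A) - CA *\<^sub>R (B - A))"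
    unfolding y_def .
  have "CAB.excenter_pt - A = (1 / z) *\<^sub>R (BC *\<^sub>R A + CA *\<^sub>R B - AB *\<^sub>R C - z *\<^sub>R A)"
    unfolding CAB.excenter_pt_def z_def[symmetric] by (rule scaleR_divide_diff[OF nz(3)])
  also have "\<dots> = (1 / z) *\<^sub>R (CA *\<^sub>R (B - A) - AB *\<^sub>R (C - A))"
    by (rule arg_cong) (simp add: z_def algebra_simps)
  finally show "CAB.excenter_pt - A = (1 / (BC + CA - AB)) *\<^sub>R (CA *\<^sub>R (B - A) - AB *\<^sub>R (C - A))"
    unfolding z_def .
qed

text \<open>The vectors \<open>CA *\<^sub>R (B - A)\<close> and \<open>AB *\<^sub>R (C - A)\<close>
  have the same length \<open>CA * AB\<close>, so their sum and their difference are
  orthogonal.\<close>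

lemma excenter_pt_orthogonal:
  "(incenter_pt - A) \<bullet> (nondegenerate_triangle.excenter_pt B C A - A) = 0"
  "(incenter_pt - A) \<bullet> (nondegenerate_triangle.excenter_pt C A B - A) = 0"
proof -
  have "(x *\<^sub>R U + y *\<^sub>R V) \<bullet> (y *\<^sub>R V - x *\<^sub>R U) = y\<^sup>2 * (V \<bullet> V) - x\<^sup>2 * (U \<bullet> U)"
    for x y :: real and U V :: "real^2"
    by (simp add: algebra_simps power2_eq_square inner_commute)
  then have 0: "(CA *\<^sub>R (B - A) + AB *\<^sub>R (C - A)) \<bullet> (AB *\<^sub>R (C - A) - CA *\<^sub>R (B - A)) = 0"
    by (simp only: edge_inner) simp
  then have 1: "(CA *\<^sub>R (B - A) + AB *\<^sub>R (C - A)) \<bullet> (CA *\<^sub>R (B - A) - AB *\<^sub>R (C - A)) = 0"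
    by (metis inner_minus_right minus_diff_eq neg_equal_0_iff_equal)
  show "(incenter_pt - A) \<bullet> (nondegenerate_triangle.excenter_pt B C A - A) = 0"
    "(incenter_pt - A) \<bullet> (nondegenerate_triangle.excenter_pt C A B - A) = 0"
    unfolding incenter_minus_vertex excenter_pt_minus_vertex inner_scaleR_left inner_scaleR_right
    using 0 1 by simp_all
qed

text \<open>This makes the circumcircle the nine-point circle of the excentral triangle. The
  midpoint \<open>M\<close> is on the external bisector at \<open>A\<close>, so \<open>M - A\<close>
  is a multiple \<open>k\<close> of a known vector, and lying on the circumcircle becomes a scalar
  identity for \<open>k\<close>. If \<open>CA = AB\<close>, then \<open>k = 0\<close> and
  \<open>M\<close> is \<open>A\<close> itself, without a separate case.\<close>

lemma dist_circumcenter_midpoint_excenters: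
  "dist ccenter (midpoint (nondegenerate_triangle.excenter_pt B C A)
     (nondegenerate_triangle.excenter_pt C A B)) = cradius"
proof -
  let ?U = "B - A" and ?V = "C - A" and ?W = "AB *\<^sub>R (C - A) - CA *\<^sub>R (B - A)"
  define y z where "y = AB + BC - CA" and "z = BC + CA - AB"
  have yz: "y \<noteq> 0" "z \<noteq> 0" using strict_triangle unfolding y_def z_def by linarith+
  define M where "M = midpoint (nondegenerate_triangle.excenter_pt B C A)
     (nondegenerate_triangle.excenter_pt C A B)"
  define k where "k = (CA - AB) / (y * z)"
  have "M - A = (1/2) *\<^sub>R ((nondegenerate_triangle.excenter_pt B C A - A)
     + (nondegenerate_triangle.excenter_pt C A B - A))"
    unfolding M_def midpoint_def eq_real2_iff by (simp add: field_simps)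
  also have "\<dots> = (1/2) *\<^sub>R ((1 / y) *\<^sub>R ?W + (1 / z) *\<^sub>R (- ?W))"
    unfolding excenter_pt_minus_vertex y_def z_def by simp
  also have "\<dots> = ((1/2) * (1/y - 1/z)) *\<^sub>R ?W"
    by (metis (no_types) diff_conv_add_uminus scaleR_left_diff_distrib scaleR_minus_right scaleR_scaleR)
  also have "(1/2) * (1/y - 1/z) = k"
    unfolding k_def using yz by (simp add: divide_simps) (simp add: y_def z_def algebra_simps)
  finally have MA: "M - A = k *\<^sub>R ?W" .
  have sq: "(v *\<^sub>R V - u *\<^sub>R U) \<bullet> (v *\<^sub>R V - u *\<^sub>R U)
      = v\<^sup>2 * (V \<bullet> V) - 2 * u * v * (U \<bullet> V) + u\<^sup>2 * (U \<bullet> U)" for u v and U V :: "real^2"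
    by (simp add: algebra_simps power2_eq_square inner_commute)
  have WW: "?W \<bullet> ?W = CA * AB * (y * z)"
    unfolding sq edge_inner y_def z_def by (simp add: field_simps power2_eq_square)
  have "2 * (?W \<bullet> (ccenter - A))
      = AB * (2 * ((ccenter - A) \<bullet> ?V)) - CA * (2 * ((ccenter - A) \<bullet> ?U))"
    by (simp only: inner_diff_left[of "AB *\<^sub>R ?V"] inner_scaleR_left inner_commute[of ?U]
      inner_commute[of ?V] right_diff_distrib mult.left_commute)
  then have WO: "2 * (?W \<bullet> (ccenter - A)) = CA * AB * (CA - AB)"
    unfolding circumcenter_inner by (simp add: power2_eq_square algebra_simps)
  have "2 * ((ccenter - A) \<bullet> (M - A)) = (M - A) \<bullet> (M - A)"
  proof -
    have "2 * ((ccenter - A) \<bullet> (M - A)) = k * (2 * (?W \<bullet> (ccenter - A)))"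
      unfolding MA by (simp only: inner_scaleR_right inner_commute[of _ "ccenter - A"])
    also have "\<dots> = k * (k * (?W \<bullet> ?W))"
      unfolding WO WW k_def using yz by simp
    finally show ?thesis unfolding MA by simp
  qed
  then have "dist ccenter A = dist ccenter M" by (simp add: dist_eq_iff_inner)
  then show ?thesis using dist_circumcenter(1) unfolding M_def by simp
qed

lemma cross2_excenters:
  "cross2 (nondegenerate_triangle.excenter_pt B C A - excenter_pt)
     (nondegenerate_triangle.excenter_pt C A B - excenter_pt)
   = 4 * BC * CA * AB * twice_area / ((CA + AB - BC) * (AB + BC - CA) * (BC + CA - AB))"
proof -
  define x y z where "x = CA + AB - BC" and "y = AB + BC - CA" and "z = BC + CA - AB"
  have nz: "x \<noteq> 0" "y \<noteq> 0" "z \<noteq> 0" using strict_triangle unfolding x_def y_def z_def by linarith+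
  let ?EA = "excenter_pt - A" and ?EB = "nondegenerate_triangle.excenter_pt B C A - A"
    and ?EC = "nondegenerate_triangle.excenter_pt C A B - A"
  have "cross2 ((1/y) *\<^sub>R (v *\<^sub>R V - u *\<^sub>R U) - (1/x) *\<^sub>R (u *\<^sub>R U + v *\<^sub>R V))
      ((1/z) *\<^sub>R (u *\<^sub>R U - v *\<^sub>R V) - (1/x) *\<^sub>R (u *\<^sub>R U + v *\<^sub>R V))
    = 2 * u * v * cross2 U V * (y + z) / (x * y * z)" for u v and U V :: "real^2"
    unfolding cross2_def using nz by (simp add: divide_simps) algebra
  then have "cross2 (?EB - ?EA) (?EC - ?EA) = 2 * CA * AB * twice_area * (y + z) / (x * y * z)"
    unfolding excenter_pt_minus_vertex x_def y_def z_def by blast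
  then show ?thesis unfolding x_def y_def z_def by simp
qed

lemma excentral_triangle_eq: "excentral_triangle (A, B, C) = (excenter_pt,
   nondegenerate_triangle.excenter_pt B C A, nondegenerate_triangle.excenter_pt C A B)"
proof -
  interpret BCA: nondegenerate_triangle B C A by (rule rotate)
  interpret CAB: nondegenerate_triangle C A B by (rule BCA.rotate)
  show ?thesis unfolding excentral_triangle_def
    by (simp add: excenter_eq BCA.excenter_eq CAB.excenter_eq)
qed

lemma nondegenerate_excentral: "nondegenerate (excentral_triangle (A, B, C))"
  unfolding excentral_triangle_eq nondegenerate_iff_cross2 cross2_excenters
  using sides_pos strict_triangle twice_area_nonzero by simp

lemma nine_point_center_excentral: "nine_point_center (excentral_triangle (A, B, C)) = ccenter"
proof -
  interpret BCA: nondegenerate_triangle B C A by (rule rotate)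
  interpret CAB: nondegenerate_triangle C A B by (rule BCA.rotate)
  let ?X = "midpoint BCA.excenter_pt CAB.excenter_pt" and ?Y = "midpoint CAB.excenter_pt excenter_pt"
    and ?Z = "midpoint excenter_pt BCA.excenter_pt"
  have "4 * cross2 (?Y - ?X) (?Z - ?X)
    = cross2 (BCA.excenter_pt - excenter_pt) (CAB.excenter_pt - excenter_pt)"
    unfolding cross2_def midpoint_def by (simp add: field_simps)
  also have "\<dots> \<noteq> 0"
    using nondegenerate_excentral unfolding excentral_triangle_eq nondegenerate_iff_cross2 .
  finally interpret M: nondegenerate_triangle ?X ?Y ?Z
    by unfold_locales (simp add: nondegenerate_iff_cross2)
  have "dist ccenter ?X = cradius" "dist ccenter ?Y = cradius" "dist ccenter ?Z = cradius"
    using dist_circumcenter_midpoint_excenters BCA.dist_circumcenter_midpoint_excenters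
      CAB.dist_circumcenter_midpoint_excenters
    by (simp_all add: circumcenter_rotate circumradius_rotate BCA.circumcenter_rotate
      BCA.circumradius_rotate)
  then show ?thesis unfolding nine_point_center_def excentral_triangle_eq prod.case
    by (intro M.circumcenter_eqI) simp_all
qed

lemma excentral_side:
  "affine hull {nondegenerate_triangle.excenter_pt B C A, nondegenerate_triangle.excenter_pt C A B}
    = {X. (incenter_pt - A) \<bullet> (X - A) = 0}"
proof (rule affine_hull_2_normal)
  show "nondegenerate_triangle.excenter_pt B C A \<noteq> nondegenerate_triangle.excenter_pt C A B"
    using nondegenerate_excentral
    unfolding excentral_triangle_eq nondegenerate_iff_cross2 by (auto simp: cross2_def)
  have "cross2 (B - A) (CA *\<^sub>R (B - A) + AB *\<^sub>R (C - A)) = AB * twice_area"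
    by (simp add: cross2_def algebra_simps)
  moreover have "cross2 (B - A) 0 = 0" by (simp add: cross2_def)
  moreover have "AB * twice_area \<noteq> 0" using sides_pos twice_area_nonzero by simp
  ultimately have "CA *\<^sub>R (B - A) + AB *\<^sub>R (C - A) \<noteq> 0" by metis
  then show "incenter_pt - A \<noteq> 0"
    unfolding incenter_minus_vertex using perimeter_pos by simp
qed (rule excenter_pt_orthogonal)+

end


section \<open>Inconics with a given center\<close>

text \<open>Moving the origin to \<open>c\<close> is a substitution of determinant 1, so
  \<open>det Q\<close> keeps its shape. At \<open>c\<close>, \<phi> is the value of the quadratic
  form and \<kappa>, \<mu> are half its gradient.\<close>

lemma polar_form_about:
  assumes "transpose Q = Q"
  obtains \<alpha> \<beta> \<gamma> \<kappa> \<mu> \<phi> where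
    "\<And>X P. homog X \<bullet> (Q *v homog P) =
       \<alpha> * (X - c)$1 * (P - c)$1 + \<beta> * ((X - c)$1 * (P - c)$2 + (X - c)$2 * (P - c)$1)
       + \<gamma> * (X - c)$2 * (P - c)$2
       + \<kappa> * ((X - c)$1 + (P - c)$1) + \<mu> * ((X - c)$2 + (P - c)$2) + \<phi>"
    "det Q = (\<alpha> * \<gamma> - \<beta>\<^sup>2) * \<phi> - (\<gamma> * \<kappa>\<^sup>2 - 2 * \<beta> * \<kappa> * \<mu> + \<alpha> * \<mu>\<^sup>2)"
proof -
  have sym: "Q$2$1 = Q$1$2" "Q$3$1 = Q$1$3" "Q$3$2 = Q$2$3"
    using assms unfolding transpose_def vec_eq_iff by simp_all
  define \<kappa> where "\<kappa> = Q$1$1 * c$1 + Q$1$2 * c$2 + Q$1$3"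
  define \<mu> where "\<mu> = Q$1$2 * c$1 + Q$2$2 * c$2 + Q$2$3"
  define \<phi> where "\<phi> = \<kappa> * c$1 + \<mu> * c$2 + Q$1$3 * c$1 + Q$2$3 * c$2 + Q$3$3"
  have "homog X \<bullet> (Q *v homog P) =
       Q$1$1 * (X - c)$1 * (P - c)$1 + Q$1$2 * ((X - c)$1 * (P - c)$2 + (X - c)$2 * (P - c)$1)
       + Q$2$2 * (X - c)$2 * (P - c)$2
       + \<kappa> * ((X - c)$1 + (P - c)$1) + \<mu> * ((X - c)$2 + (P - c)$2) + \<phi>" for X P
    unfolding \<phi>_def \<kappa>_def \<mu>_def homog_def
    by (simp add: inner_vec_def matrix_vector_mult_def sum_3 sym algebra_simps)
  moreover have "det Q = (Q$1$1 * Q$2$2 - (Q$1$2)\<^sup>2) * \<phi>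
      - (Q$2$2 * \<kappa>\<^sup>2 - 2 * Q$1$2 * \<kappa> * \<mu> + Q$1$1 * \<mu>\<^sup>2)"
    unfolding \<phi>_def \<kappa>_def \<mu>_def det_3 sym by (simp add: algebra_simps power2_eq_square)
  ultimately show thesis using that by blast
qed

(* If the gradient at the center of symmetry c did not vanish, the whole conic would lie
   on a line through c, and three collinear points force det Q = 0. *)
lemma centered_conic:
  assumes "conic_matrix Q" "centered_at (conic_of Q) c"
    and pts: "P1 \<in> conic_of Q" "P2 \<in> conic_of Q" "P3 \<in> conic_of Q" "P1 \<noteq> P2" "P2 \<noteq> P3" "P3 \<noteq> P1"
  obtains \<alpha> \<beta> \<gamma> \<phi> where
    "\<And>X P. homog X \<bullet> (Q *v homog P) =
       \<alpha> * (X - c)$1 * (P - c)$1 + \<beta> * ((X - c)$1 * (P - c)$2 + (X - c)$2 * (P - c)$1)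
       + \<gamma> * (X - c)$2 * (P - c)$2 + \<phi>"
    "\<alpha> * \<gamma> - \<beta>\<^sup>2 \<noteq> 0" "\<phi> \<noteq> 0"
proof -
  have "transpose Q = Q" and det: "det Q \<noteq> 0" using assms(1) by (auto simp: conic_matrix_def)
  obtain \<alpha> \<beta> \<gamma> \<kappa> \<mu> \<phi> where form: "\<And>X P. homog X \<bullet> (Q *v homog P) =
       \<alpha> * (X - c)$1 * (P - c)$1 + \<beta> * ((X - c)$1 * (P - c)$2 + (X - c)$2 * (P - c)$1)
       + \<gamma> * (X - c)$2 * (P - c)$2
       + \<kappa> * ((X - c)$1 + (P - c)$1) + \<mu> * ((X - c)$2 + (P - c)$2) + \<phi>"
    and detQ: "det Q = (\<alpha> * \<gamma> - \<beta>\<^sup>2) * \<phi> - (\<gamma> * \<kappa>\<^sup>2 - 2 * \<beta> * \<kappa> * \<mu> + \<alpha> * \<mu>\<^sup>2)"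
    by (rule polar_form_about[OF \<open>transpose Q = Q\<close>, of c]) blast
  have lin: "\<kappa> * (P - c)$1 + \<mu> * (P - c)$2 = 0" if "P \<in> conic_of Q" for P
  proof -
    have "2 *\<^sub>R c - P \<in> conic_of Q" using that assms(2) unfolding centered_at_def by blast
    then have "homog (2 *\<^sub>R c - P) \<bullet> (Q *v homog (2 *\<^sub>R c - P)) = 0" "homog P \<bullet> (Q *v homog P) = 0"
      using that unfolding conic_of_def by blast+
    moreover have "(2 *\<^sub>R c - P - c)$1 = - ((P - c)$1)" "(2 *\<^sub>R c - P - c)$2 = - ((P - c)$2)" by simp_all
    ultimately show ?thesis unfolding form by (simp only:) algebra
  qed
  have "\<kappa> = 0 \<and> \<mu> = 0"
  proof (rule ccontr)
    assume "\<not> (\<kappa> = 0 \<and> \<mu> = 0)"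
    then have kk: "\<kappa>\<^sup>2 + \<mu>\<^sup>2 \<noteq> 0" by (simp add: sum_power2_eq_zero_iff)
    \<comment> \<open>Coordinate of \<open>P\<close> on the line through \<open>c\<close> with
      direction \<open>(- \<mu>, \<kappa>)\<close>. There the conic restricts to the even polynomial
      \<open>\<delta> * t\<^sup>2 + \<phi>\<close>, which vanishes at three distinct parameters only
      if both coefficients are zero.\<close>
    define t where "t P = (\<kappa> * (P - c)$2 - \<mu> * (P - c)$1) / (\<kappa>\<^sup>2 + \<mu>\<^sup>2)" for P
    have t: "(P - c)$1 = - \<mu> * t P" "(P - c)$2 = \<kappa> * t P" if "P \<in> conic_of Q" for P
      unfolding t_def using lin[OF that] kk by (simp_all add: field_simps; algebra)+
    define \<delta> where "\<delta> = \<gamma> * \<kappa>\<^sup>2 - 2 * \<beta> * \<kappa> * \<mu> + \<alpha> * \<mu>\<^sup>2"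
    have root: "\<delta> * (t P)\<^sup>2 + \<phi> = 0" if P: "P \<in> conic_of Q" for P
    proof -
      have "homog P \<bullet> (Q *v homog P) = 0" using P unfolding conic_of_def by blast
      then show ?thesis unfolding form t[OF P] \<delta>_def by algebra
    qed
    have inj: "P = P'" if "P \<in> conic_of Q" "P' \<in> conic_of Q" "t P = t P'" for P P'
      using t[OF that(1)] t[OF that(2)] that(3) by (simp add: eq_real2_iff)
    have "t P1 \<noteq> t P2" "t P2 \<noteq> t P3" "t P3 \<noteq> t P1" using inj pts by blast+
    moreover have "\<delta> * ((t P1)\<^sup>2 - (t P2)\<^sup>2) = 0" "\<delta> * ((t P2)\<^sup>2 - (t P3)\<^sup>2) = 0"
      using root[OF pts(1)] root[OF pts(2)] root[OF pts(3)] by algebra+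
    ultimately have "\<delta> = 0" by (auto simp: power2_eq_iff)
    then have "\<phi> = 0" using root[OF pts(1)] by simp
    then show False using det detQ \<open>\<delta> = 0\<close> by (simp add: \<delta>_def)
  qed
  then show thesis using that[of \<alpha> \<beta> \<gamma> \<phi>] form det detQ by auto
qed

text \<open>Two equations of one line are proportional. The cross-multiplied form also covers a line
  through the origin, where \<open>e\<close> and \<phi> both vanish. The proof compares the
  equations at the point \<open>Y\<close> nearest to the origin and at a second point
  \<open>Y + p\<close>.\<close>

lemma line_coefficients:
  fixes n m :: "real^2"
  assumes "n \<noteq> 0" and eq: "\<And>Y. n \<bullet> Y = e \<longleftrightarrow> m \<bullet> Y + \<phi> = 0"
  shows "e *\<^sub>R m = - \<phi> *\<^sub>R n"
proof -
  have nn: "n \<bullet> n \<noteq> 0" using assms(1) by simp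
  define Y where "Y = (e / (n \<bullet> n)) *\<^sub>R n"
  have Y: "(n \<bullet> n) *\<^sub>R Y = e *\<^sub>R n" unfolding Y_def using nn by simp
  define p :: "real^2" where "p = vector [- n$2, n$1]"
  have p: "n \<bullet> p = 0" "m \<bullet> p = cross2 n m" by (simp_all add: p_def inner_real2 cross2_def)
  have "n \<bullet> Y = e" "n \<bullet> (Y + p) = e" using nn p by (simp_all add: Y_def inner_add_right)
  then have m: "m \<bullet> Y + \<phi> = 0" "m \<bullet> (Y + p) + \<phi> = 0" using eq by blast+
  then have cr: "cross2 n m = 0" using p by (simp add: inner_add_right)
  have "e * (m \<bullet> n) = (n \<bullet> n) * (m \<bullet> Y)"
    by (metis Y inner_scaleR_right)
  also have "\<dots> = - \<phi> * (n \<bullet> n)" using eq_neg_iff_add_eq_0[THEN iffD2, OF m(1)] by simp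
  finally have *: "e * (m \<bullet> n) = - \<phi> * (n \<bullet> n)" .
  have "(n \<bullet> n) *\<^sub>R m = (m \<bullet> n) *\<^sub>R n"
    using cr unfolding cross2_def eq_real2_iff inner_real2 by (simp, intro conjI; algebra)
  then have "(n \<bullet> n) *\<^sub>R (e *\<^sub>R m) = (e * (m \<bullet> n)) *\<^sub>R n"
    by (metis scaleR_scaleR mult.commute)
  also have "\<dots> = (n \<bullet> n) *\<^sub>R (- \<phi> *\<^sub>R n)" unfolding * by simp
  finally show ?thesis using nn by (simp only: scaleR_cancel_left) simp
qed

(* The tangency condition is linear in the inverse [[u, v], [v, w]] of the matrix
   of the conic (the dual conic). *)
lemma centered_inconic_dual:
  assumes "conic_matrix Q" "centered_at (conic_of Q) c"
    and tangent: "tangent_to_conic L1 Q" "tangent_to_conic L2 Q" "tangent_to_conic L3 Q"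
    and distinct: "L1 \<noteq> L2" "L2 \<noteq> L3" "L3 \<noteq> L1"
  obtains u v w where
    "conic_of Q = {X. w * ((X - c)$1)\<^sup>2 - 2 * v * (X - c)$1 * (X - c)$2 + u * ((X - c)$2)\<^sup>2 = u * w - v\<^sup>2}"
    "\<And>L n e. L \<in> {L1, L2, L3} \<Longrightarrow> n \<noteq> 0 \<Longrightarrow> L = {X. n \<bullet> (X - c) = e} \<Longrightarrow>
       u * (n$1)\<^sup>2 + 2 * v * n$1 * n$2 + w * (n$2)\<^sup>2 = e\<^sup>2"
proof -
  obtain P1 P2 P3 where P: "P1 \<in> conic_of Q" "P2 \<in> conic_of Q" "P3 \<in> conic_of Q"
    and L: "L1 = {X. homog X \<bullet> (Q *v homog P1) = 0}" "L2 = {X. homog X \<bullet> (Q *v homog P2) = 0}"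
      "L3 = {X. homog X \<bullet> (Q *v homog P3) = 0}"
    using tangent unfolding tangent_to_conic_def by blast
  have "P1 \<noteq> P2" "P2 \<noteq> P3" "P3 \<noteq> P1" using L distinct by blast+
  from centered_conic[OF assms(1,2) P this]
  obtain \<alpha> \<beta> \<gamma> \<phi> where form: "\<And>X P. homog X \<bullet> (Q *v homog P) =
       \<alpha> * (X - c)$1 * (P - c)$1 + \<beta> * ((X - c)$1 * (P - c)$2 + (X - c)$2 * (P - c)$1)
       + \<gamma> * (X - c)$2 * (P - c)$2 + \<phi>"
    and nz: "\<alpha> * \<gamma> - \<beta>\<^sup>2 \<noteq> 0" "\<phi> \<noteq> 0" by blast
  define \<Delta> where "\<Delta> = \<alpha> * \<gamma> - \<beta>\<^sup>2"
  have \<Delta>: "\<Delta> \<noteq> 0" using nz unfolding \<Delta>_def by simp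
  \<comment> \<open>Dividing the equation of the conic by \<open>- \<phi>\<close> makes its
    right-hand side 1; these are the entries of the inverse of the matrix so normalised. The
    arbitrary scale of \<open>Q\<close> drops out, so the set is recovered from \<open>u\<close>,
    \<open>v\<close>, \<open>w\<close>.\<close>
  define u v w where "u = - \<phi> * \<gamma> / \<Delta>" and "v = \<phi> * \<beta> / \<Delta>" and "w = - \<phi> * \<alpha> / \<Delta>"
  have uvw: "\<Delta> * u = - \<phi> * \<gamma>" "\<Delta> * v = \<phi> * \<beta>" "\<Delta> * w = - \<phi> * \<alpha>"
    unfolding u_def v_def w_def using \<Delta> by simp_all
  have "\<Delta> * (\<Delta> * (u * w - v\<^sup>2)) = \<Delta> * \<phi>\<^sup>2" using uvw unfolding \<Delta>_def by algebra
  then have uwv: "\<Delta> * (u * w - v\<^sup>2) = \<phi>\<^sup>2" using \<Delta> by simp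
  show thesis
  proof (rule that)
    have "homog X \<bullet> (Q *v homog X) = 0 \<longleftrightarrow>
      w * ((X - c)$1)\<^sup>2 - 2 * v * (X - c)$1 * (X - c)$2 + u * ((X - c)$2)\<^sup>2 = u * w - v\<^sup>2" for X
    proof -
      have "\<Delta> * (w * ((X - c)$1)\<^sup>2 - 2 * v * (X - c)$1 * (X - c)$2 + u * ((X - c)$2)\<^sup>2 - (u * w - v\<^sup>2))
        = - \<phi> * (homog X \<bullet> (Q *v homog X))"
        using uvw uwv unfolding form by algebra
      then show ?thesis using \<Delta> nz(2) by auto
    qed
    then show "conic_of Q = {X. w * ((X - c)$1)\<^sup>2 - 2 * v * (X - c)$1 * (X - c)$2
        + u * ((X - c)$2)\<^sup>2 = u * w - v\<^sup>2}" unfolding conic_of_def by blast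
  next
    fix L n e assume LL: "L \<in> {L1, L2, L3}" and n: "n \<noteq> 0" and Le: "L = {X. n \<bullet> (X - c) = e}"
    obtain P where P: "P \<in> conic_of Q" "L = {X. homog X \<bullet> (Q *v homog P) = 0}"
      using LL L P by blast
    \<comment> \<open>The polar of \<open>P\<close> is \<open>m \<bullet> Y + \<phi> = 0\<close>
      with \<open>Y = X - c\<close>. Once \<open>m\<close> is expressed by \<open>n\<close>, the
      condition that \<open>P\<close> lies on its own polar is the dual equation for
      \<open>n\<close> and \<open>e\<close>.\<close>
    define m :: "real^2" where "m = vector [\<alpha> * (P - c)$1 + \<beta> * (P - c)$2, \<beta> * (P - c)$1 + \<gamma> * (P - c)$2]"
    have m: "m$1 = \<alpha> * (P - c)$1 + \<beta> * (P - c)$2" "m$2 = \<beta> * (P - c)$1 + \<gamma> * (P - c)$2"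
      unfolding m_def by simp_all
    have "n \<bullet> Y = e \<longleftrightarrow> m \<bullet> Y + \<phi> = 0" for Y
    proof -
      have "c + Y \<in> {X. n \<bullet> (X - c) = e} \<longleftrightarrow> c + Y \<in> {X. homog X \<bullet> (Q *v homog P) = 0}"
        using Le P(2) by simp
      then show ?thesis unfolding form by (simp add: inner_real2 m algebra_simps)
    qed
    from line_coefficients[OF n this] have em: "e * m$1 = - \<phi> * n$1" "e * m$2 = - \<phi> * n$2"
      by (simp_all add: eq_real2_iff)
    have "homog P \<bullet> (Q *v homog P) = 0" using P(1) unfolding conic_of_def by blast
    then have "(P - c)$1 * m$1 + (P - c)$2 * m$2 = - \<phi>" unfolding form m by algebra
    then have "\<gamma> * (m$1)\<^sup>2 - 2 * \<beta> * m$1 * m$2 + \<alpha> * (m$2)\<^sup>2 = - \<phi> * \<Delta>"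
      using m unfolding \<Delta>_def by algebra
    then have "\<phi>\<^sup>2 * (\<gamma> * (n$1)\<^sup>2 - 2 * \<beta> * n$1 * n$2 + \<alpha> * (n$2)\<^sup>2) = - \<phi> * \<Delta> * e\<^sup>2"
      using em by algebra
    then have "\<phi> * (\<Delta> * (u * (n$1)\<^sup>2 + 2 * v * n$1 * n$2 + w * (n$2)\<^sup>2)) = \<phi> * (\<Delta> * e\<^sup>2)"
      using uvw by algebra
    then show "u * (n$1)\<^sup>2 + 2 * v * n$1 * n$2 + w * (n$2)\<^sup>2 = e\<^sup>2" using nz(2) \<Delta> by simp
  qed
qed

text \<open>A nonzero binary quadratic form has at most two zeros on the projective line. The
  identities in the proof are Cramer's rule; the determinant factors, as for Vandermonde, into the
  three cross products up to a constant.\<close>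

lemma binary_quadratic_form_eq_0:
  fixes l m n :: "real^2"
  assumes "u * (l$1)\<^sup>2 + 2 * v * l$1 * l$2 + w * (l$2)\<^sup>2 = 0"
    and "u * (m$1)\<^sup>2 + 2 * v * m$1 * m$2 + w * (m$2)\<^sup>2 = 0"
    and "u * (n$1)\<^sup>2 + 2 * v * n$1 * n$2 + w * (n$2)\<^sup>2 = 0"
    and "cross2 l m \<noteq> 0" "cross2 m n \<noteq> 0" "cross2 n l \<noteq> 0"
  shows "u = 0 \<and> v = 0 \<and> w = 0"
proof -
  let ?D = "cross2 l m * cross2 m n * cross2 n l"
  let ?q = "\<lambda>x::real^2. u * (x$1)\<^sup>2 + 2 * v * x$1 * x$2 + w * (x$2)\<^sup>2"
  have "?D * u = - (m$2 * n$2 * cross2 m n * ?q l + n$2 * l$2 * cross2 n l * ?q m + l$2 * m$2 * cross2 l m * ?q n)"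
    "?D * w = - (m$1 * n$1 * cross2 m n * ?q l + n$1 * l$1 * cross2 n l * ?q m + l$1 * m$1 * cross2 l m * ?q n)"
    "2 * (?D * v) = (m$1 * n$2 + m$2 * n$1) * cross2 m n * ?q l + (n$1 * l$2 + n$2 * l$1) * cross2 n l * ?q m
      + (l$1 * m$2 + l$2 * m$1) * cross2 l m * ?q n"
    unfolding cross2_def by (simp_all add: algebra_simps power2_eq_square)
  then have "?D * u = 0" "?D * v = 0" "?D * w = 0" unfolding assms(1-3) by simp_all
  then show ?thesis using assms(4-6) by simp
qed

text \<open>Two dual conics take the same value \<open>e\<^sup>2\<close> at each side normal, a
  quarter turn \<open>N\<close> of the side direction. Their difference is a binary form with three
  pairwise independent zeros.\<close>

lemma inconic_unique:
  assumes nd: "nondegenerate T" and "inconic T S" "inconic T S'"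
    and cent: "centered_at S c" "centered_at S' c"
  shows "S = S'"
proof -
  obtain A B C where T: "T = (A, B, C)" by (cases T) auto
  have D: "cross2 (B - A) (C - A) \<noteq> 0" using nd T by (simp add: nondegenerate_iff_cross2)
  then have ne: "B \<noteq> C" "C \<noteq> A" "A \<noteq> B" by (auto simp: cross2_def)
  let ?L1 = "affine hull {B, C}" and ?L2 = "affine hull {C, A}" and ?L3 = "affine hull {A, B}"
  obtain Q Q' where Q: "conic_matrix Q" "S = conic_of Q"
      "tangent_to_conic ?L1 Q" "tangent_to_conic ?L2 Q" "tangent_to_conic ?L3 Q"
    and Q': "conic_matrix Q'" "S' = conic_of Q'"
      "tangent_to_conic ?L1 Q'" "tangent_to_conic ?L2 Q'" "tangent_to_conic ?L3 Q'"
    using assms(2,3) unfolding T inconic_def by auto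
  have lines: "?L1 = {X. cross2 (C - B) (X - B) = 0}" "?L2 = {X. cross2 (A - C) (X - C) = 0}"
    "?L3 = {X. cross2 (B - A) (X - A) = 0}"
    using affine_hull_2_cross2 ne by blast+
  have "A \<notin> ?L1" "B \<notin> ?L2" "C \<notin> ?L3" "B \<in> ?L1" "C \<in> ?L2" "A \<in> ?L3"
    using D unfolding lines by (auto simp: cross2_def algebra_simps)
  then have dist: "?L1 \<noteq> ?L2" "?L2 \<noteq> ?L3" "?L3 \<noteq> ?L1" by blast+
  obtain u v w where S: "S = {X. w * ((X - c)$1)\<^sup>2 - 2 * v * (X - c)$1 * (X - c)$2
        + u * ((X - c)$2)\<^sup>2 = u * w - v\<^sup>2}"
    and dual: "\<And>L n e. L \<in> {?L1, ?L2, ?L3} \<Longrightarrow> n \<noteq> 0 \<Longrightarrow> L = {X. n \<bullet> (X - c) = e} \<Longrightarrow>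
       u * (n$1)\<^sup>2 + 2 * v * n$1 * n$2 + w * (n$2)\<^sup>2 = e\<^sup>2"
    unfolding Q(2) by (rule centered_inconic_dual[OF Q(1) cent(1)[unfolded Q(2)] Q(3-5) dist]) blast
  obtain u' v' w' where S': "S' = {X. w' * ((X - c)$1)\<^sup>2 - 2 * v' * (X - c)$1 * (X - c)$2
        + u' * ((X - c)$2)\<^sup>2 = u' * w' - v'\<^sup>2}"
    and dual': "\<And>L n e. L \<in> {?L1, ?L2, ?L3} \<Longrightarrow> n \<noteq> 0 \<Longrightarrow> L = {X. n \<bullet> (X - c) = e} \<Longrightarrow>
       u' * (n$1)\<^sup>2 + 2 * v' * n$1 * n$2 + w' * (n$2)\<^sup>2 = e\<^sup>2"
    unfolding Q'(2) by (rule centered_inconic_dual[OF Q'(1) cent(2)[unfolded Q'(2)] Q'(3-5) dist]) blast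
  define N :: "real^2 \<Rightarrow> real^2" where "N x = vector [- x$2, x$1]" for x
  have N: "N x \<bullet> (X - c) = N x \<bullet> (P - c) \<longleftrightarrow> cross2 x (X - P) = 0" for x X P
    by (auto simp: N_def inner_real2 cross2_def algebra_simps)
  have N0: "N x \<noteq> 0" if "x \<noteq> 0" for x using that by (auto simp: N_def eq_real2_iff)
  have Ncross: "cross2 (N x) (N y) = cross2 x y" for x y by (simp add: N_def cross2_def)
  have diff: "(u - u') * (N x$1)\<^sup>2 + 2 * (v - v') * N x$1 * N x$2 + (w - w') * (N x$2)\<^sup>2 = 0"
    if "L \<in> {?L1, ?L2, ?L3}" "L = {X. cross2 x (X - P) = 0}" "x \<noteq> 0" for L x P
    using dual[OF that(1) N0[OF that(3)], of "N x \<bullet> (P - c)"] dual'[OF that(1) N0[OF that(3)], of "N x \<bullet> (P - c)"]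
    unfolding N that(2) by (simp add: algebra_simps)
  have "u - u' = 0 \<and> v - v' = 0 \<and> w - w' = 0"
  proof (rule binary_quadratic_form_eq_0)
    show "(u - u') * (N (C - B)$1)\<^sup>2 + 2 * (v - v') * N (C - B)$1 * N (C - B)$2 + (w - w') * (N (C - B)$2)\<^sup>2 = 0"
      using diff[OF _ lines(1)] ne by simp
    show "(u - u') * (N (A - C)$1)\<^sup>2 + 2 * (v - v') * N (A - C)$1 * N (A - C)$2 + (w - w') * (N (A - C)$2)\<^sup>2 = 0"
      using diff[OF _ lines(2)] ne by simp
    show "(u - u') * (N (B - A)$1)\<^sup>2 + 2 * (v - v') * N (B - A)$1 * N (B - A)$2 + (w - w') * (N (B - A)$2)\<^sup>2 = 0"
      using diff[OF _ lines(3)] ne by simp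
  qed (use D in \<open>simp_all add: Ncross, simp_all add: cross2_def algebra_simps\<close>)
  then show ?thesis unfolding S S' by simp
qed


section \<open>The MacBeath inconic of the excentral triangle\<close>

text \<open>Center \<open>c\<close>, foci \<open>c + g\<close> and \<open>c - g\<close>, major semiaxis \<open>\<rho>\<close>.\<close>

definition focal_ellipse :: "real^2 \<Rightarrow> real^2 \<Rightarrow> real \<Rightarrow> (real^2) set" where
  "focal_ellipse c g \<rho> =
     {X. \<rho>\<^sup>2 * ((X - c) \<bullet> (X - c)) - (g \<bullet> (X - c))\<^sup>2 = \<rho>\<^sup>2 * (\<rho>\<^sup>2 - g \<bullet> g)}"

lemma reflection_diff: "2 *\<^sub>R c - P - c = - (P - c)" for c :: "'a::real_vector"
  by (simp add: scaleR_2)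

lemma centered_at_focal_ellipse: "centered_at (focal_ellipse c g \<rho>) c"
  unfolding centered_at_def focal_ellipse_def
  by (simp only: mem_Collect_eq reflection_diff inner_minus_left inner_minus_right power2_minus
      minus_minus ball_simps simp_thms)

lemma inner_less_square:
  assumes "norm g < \<rho>"
  shows "g \<bullet> g < \<rho>\<^sup>2" and "norm h = \<rho> \<Longrightarrow> g \<bullet> h < \<rho>\<^sup>2"
proof -
  have \<rho>: "\<rho> > 0" using assms norm_ge_zero[of g] by linarith
  show "g \<bullet> g < \<rho>\<^sup>2"
    using assms by (simp add: power_strict_mono flip: power2_norm_eq_inner)
  assume "norm h = \<rho>"
  then have "g \<bullet> h \<le> norm g * \<rho>" using norm_cauchy_schwarz[of g h] by simp
  also have "\<dots> < \<rho> * \<rho>" using assms \<rho> by simp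
  finally show "g \<bullet> h < \<rho>\<^sup>2" by (simp add: power2_eq_square)
qed

lemma focal_ellipse_conic:
  assumes "norm g < \<rho>"
  obtains Q where "conic_matrix Q" "focal_ellipse c g \<rho> = conic_of Q"
    "\<And>X P. homog X \<bullet> (Q *v homog P) =
      \<rho>\<^sup>2 * ((X - c) \<bullet> (P - c)) - (g \<bullet> (X - c)) * (g \<bullet> (P - c)) - \<rho>\<^sup>2 * (\<rho>\<^sup>2 - g \<bullet> g)"
proof -
  define m where "m = \<rho>\<^sup>2 * (\<rho>\<^sup>2 - g \<bullet> g)"
  have "\<rho> > 0" using assms norm_ge_zero[of g] by linarith
  then have m: "m > 0" unfolding m_def using inner_less_square(1)[OF assms] by simp
  \<comment> \<open>The matrix \<open>[[p, q], [q, r]]\<close> is \<rho> squared times the identity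
    minus the outer product of \<open>g\<close> with itself, and its determinant is
    \<open>m\<close>. The entries \<open>s\<close>, \<open>t\<close>, \<open>z\<close> shift the
    center to \<open>c\<close>, which leads to \<open>det Q = - m\<^sup>2\<close>.\<close>
  define p q r where "p = \<rho>\<^sup>2 - (g$1)\<^sup>2" and "q = - g$1 * g$2" and "r = \<rho>\<^sup>2 - (g$2)\<^sup>2"
  define s t where "s = - (p * c$1 + q * c$2)" and "t = - (q * c$1 + r * c$2)"
  define z where "z = p * (c$1)\<^sup>2 + 2 * q * c$1 * c$2 + r * (c$2)\<^sup>2 - m"
  define Q :: "real^3^3" where "Q = vector [vector [p, q, s], vector [q, r, t], vector [s, t, z]]"
  have "homog X \<bullet> (Q *v homog P) =
      \<rho>\<^sup>2 * ((X - c) \<bullet> (P - c)) - (g \<bullet> (X - c)) * (g \<bullet> (P - c)) - m" for X P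
    unfolding inner_real2 Q_def homog_def
    by (simp add: inner_vec_def matrix_vector_mult_def sum_3 s_def t_def z_def)
      (simp add: p_def q_def r_def algebra_simps power2_eq_square)
  note form = this[unfolded m_def]
  have "det Q = - m * (p * r - q\<^sup>2)"
    unfolding det_3 by (simp add: Q_def) (simp add: s_def t_def z_def algebra_simps power2_eq_square)
  also have "p * r - q\<^sup>2 = m"
    unfolding p_def q_def r_def m_def inner_real2 by (simp add: algebra_simps power2_eq_square)
  finally have "det Q \<noteq> 0" using m by simp
  moreover have "transpose Q = Q"
    unfolding transpose_def Q_def by (simp add: vec_eq_iff forall_3)
  ultimately have "conic_matrix Q" unfolding conic_matrix_def by simp
  moreover have "focal_ellipse c g \<rho> = conic_of Q"
    unfolding conic_of_def form focal_ellipse_def by (simp add: power2_eq_square)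
  ultimately show thesis using that form by blast
qed

lemma focal_ellipse_tangent:
  assumes g: "norm g < \<rho>" and h: "norm h = \<rho>"
    and Q: "\<And>X P. homog X \<bullet> (Q *v homog P) =
        \<rho>\<^sup>2 * ((X - c) \<bullet> (P - c)) - (g \<bullet> (X - c)) * (g \<bullet> (P - c)) - \<rho>\<^sup>2 * (\<rho>\<^sup>2 - g \<bullet> g)"
  shows "tangent_to_conic {X. (g - h) \<bullet> (X - (c + h)) = 0} Q"
proof -
  define e where "e = \<rho>\<^sup>2 - g \<bullet> h"
  have e: "e > 0" using inner_less_square(2)[OF g h] unfolding e_def by simp
  have hh: "h \<bullet> h = \<rho>\<^sup>2" using h by (simp flip: power2_norm_eq_inner)
  have \<rho>: "\<rho> \<noteq> 0" using g norm_ge_zero[of g] by linarith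
  \<comment> \<open>The point of contact is sought as \<open>(c - g) + k *\<^sub>R h\<close>: the
    line joining it to the other focus \<open>c - g\<close> is parallel to the radius
    \<open>h\<close> that ends at the foot of the perpendicular from \<open>c + g\<close>. Lying on
    the given line forces this \<open>k\<close>.\<close>
  define k where "k = (\<rho>\<^sup>2 - g \<bullet> g) / e"
  have k: "k * (\<rho>\<^sup>2 - g \<bullet> h) = \<rho>\<^sup>2 - g \<bullet> g" "k \<noteq> 0"
    unfolding k_def using e inner_less_square(1)[OF g] by (auto simp: e_def)
  define P where "P = c + (k *\<^sub>R h - g)"
  have gP: "g \<bullet> (P - c) = \<rho>\<^sup>2 * (k - 1)"
    using k(1) unfolding P_def by (simp add: inner_diff_right algebra_simps)
  have polar: "homog X \<bullet> (Q *v homog P) = - \<rho>\<^sup>2 * k * ((g - h) \<bullet> (X - (c + h)))" for X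
  proof -
    define Y where "Y = X - c"
    have X: "X - (c + h) = Y - h" unfolding Y_def by simp
    have "Y \<bullet> (P - c) = k * (h \<bullet> Y) - g \<bullet> Y"
      unfolding P_def by (simp add: inner_diff_right inner_commute)
    moreover have "(g - h) \<bullet> (Y - h) = g \<bullet> Y - h \<bullet> Y - g \<bullet> h + \<rho>\<^sup>2"
      unfolding hh[symmetric] by (simp add: algebra_simps)
    ultimately show ?thesis unfolding Q gP X Y_def[symmetric] using k(1) by algebra
  qed
  have "(g - h) \<bullet> (P - (c + h)) = k * (g \<bullet> h - \<rho>\<^sup>2) + (\<rho>\<^sup>2 - g \<bullet> g)"
    unfolding P_def hh[symmetric] by (simp add: algebra_simps inner_commute)
  then have "(g - h) \<bullet> (P - (c + h)) = 0" using k(1) by algebra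
  then have "P \<in> conic_of Q" unfolding conic_of_def mem_Collect_eq polar by (simp only: mult_zero_right)
  moreover have "(g - h) \<bullet> (X - (c + h)) = 0 \<longleftrightarrow> homog X \<bullet> (Q *v homog P) = 0" for X
  proof -
    have "- \<rho>\<^sup>2 * k \<noteq> 0" using \<rho> k(2) by simp
    then show ?thesis unfolding polar by (simp only: mult_eq_0_iff simp_thms)
  qed
  ultimately show ?thesis unfolding tangent_to_conic_def by blast
qed

lemma (in nondegenerate_triangle) macbeath_inconic_excentral:
  "macbeath_inconic (excentral_triangle (A, B, C))
     = focal_ellipse ccenter (incenter_pt - ccenter) cradius"
proof -
  interpret BCA: nondegenerate_triangle B C A by (rule rotate)
  interpret CAB: nondegenerate_triangle C A B by (rule BCA.rotate)
  let ?g = "incenter_pt - ccenter"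
  let ?E = "focal_ellipse ccenter ?g cradius"
  have "(dist incenter_pt ccenter)\<^sup>2 < cradius\<^sup>2"
    unfolding euler_power using sides_pos perimeter_pos by simp
  then have g: "norm ?g < cradius"
    using circumradius_pos by (simp add: dist_norm power2_less_imp_less)
  obtain Q where Q: "conic_matrix Q" "?E = conic_of Q"
    "\<And>X P. homog X \<bullet> (Q *v homog P) = cradius\<^sup>2 * ((X - ccenter) \<bullet> (P - ccenter))
      - (?g \<bullet> (X - ccenter)) * (?g \<bullet> (P - ccenter)) - cradius\<^sup>2 * (cradius\<^sup>2 - ?g \<bullet> ?g)"
    by (rule focal_ellipse_conic[OF g, of ccenter]) blast
  have tangent: "tangent_to_conic {X. (incenter_pt - V) \<bullet> (X - V) = 0} Q"
    if "dist ccenter V = cradius" for V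
  proof -
    have "norm (V - ccenter) = cradius" using that by (simp add: dist_norm norm_minus_commute)
    from focal_ellipse_tangent[OF g this Q(3)] show ?thesis by simp
  qed
  note sides = excentral_side BCA.excentral_side[unfolded incenter_pt_rotate]
    CAB.excentral_side[unfolded BCA.incenter_pt_rotate incenter_pt_rotate]
  have "inconic (excentral_triangle (A, B, C)) ?E"
    unfolding excentral_triangle_eq inconic_def prod.case sides
    using Q(1,2) dist_circumcenter[THEN tangent] by blast
  then show ?thesis unfolding macbeath_inconic_def nine_point_center_excentral
    using inconic_unique[OF nondegenerate_excentral] centered_at_focal_ellipse
    by (intro the_equality) blast+
qed

section \<open>Semiaxes\<close>

lemma inner_self_orthonormal:
  fixes u v Y :: "real^2"
  assumes "norm u = 1" "norm v = 1" "u \<bullet> v = 0"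
  shows "Y \<bullet> Y = (Y \<bullet> u)\<^sup>2 + (Y \<bullet> v)\<^sup>2"
proof -
  have u: "u \<bullet> u = 1" and v: "v \<bullet> v = 1" using assms by (simp_all flip: power2_norm_eq_inner)
  have c: "(cross2 u v)\<^sup>2 = 1" unfolding cross2_squared u v assms(3) by simp
  \<comment> \<open>In the plane, a unit vector orthogonal to \<open>u\<close> is its quarter turn
    up to the sign \<open>cross2 u v\<close>.\<close>
  have "v$1 = - cross2 u v * u$2" "v$2 = cross2 u v * u$1"
    using u assms(3) unfolding inner_real2 cross2_def by algebra+
  then have "(Y \<bullet> v)\<^sup>2 = (cross2 u v)\<^sup>2 * (cross2 u Y)\<^sup>2"
    unfolding inner_real2 cross2_def[of u Y] by algebra
  also have "\<dots> = Y \<bullet> Y - (Y \<bullet> u)\<^sup>2"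
    unfolding c cross2_squared[of u Y] u by (simp add: inner_commute)
  finally show ?thesis by simp
qed

lemma ellipse_with_semiaxes_focal_ellipse:
  assumes "norm g < \<rho>"
  shows "ellipse_with_semiaxes (focal_ellipse c g \<rho>) \<rho> (sqrt (\<rho>\<^sup>2 - g \<bullet> g))"
proof -
  have \<rho>: "\<rho> > 0" using assms norm_ge_zero[of g] by linarith
  define m where "m = \<rho>\<^sup>2 - g \<bullet> g"
  have m: "m > 0" unfolding m_def using inner_less_square(1)[OF assms] by simp
  have "m \<le> \<rho>\<^sup>2" unfolding m_def by simp
  then have le: "sqrt m \<le> \<rho>" using \<rho> real_le_lsqrt by fastforce
  \<comment> \<open>For \<open>g = 0\<close> the foci coincide and the ellipse is a circle, so any
    unit vector serves as axis direction.\<close>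
  obtain u :: "real^2" where u: "norm u = 1" "g = norm g *\<^sub>R u"
  proof (cases "g = 0")
    case True
    then show thesis using that[of "axis 1 1"] by (simp add: norm_axis_1)
  next
    case False
    then show thesis using that[of "sgn g"] by (simp add: norm_sgn sgn_div_norm)
  qed
  define v :: "real^2" where "v = vector [- u$2, u$1]"
  have "u \<bullet> u = 1" using u(1) by (simp flip: power2_norm_eq_inner)
  then have "v \<bullet> v = 1" "u \<bullet> v = 0" by (simp_all add: v_def inner_real2)
  then have v: "norm v = 1" "u \<bullet> v = 0" by (simp_all add: norm_eq_sqrt_inner)
  have "\<rho>\<^sup>2 * (Y \<bullet> Y) - (g \<bullet> Y)\<^sup>2 = \<rho>\<^sup>2 * m \<longleftrightarrow> (Y \<bullet> u)\<^sup>2 / \<rho>\<^sup>2 + (Y \<bullet> v)\<^sup>2 / m = 1" for Y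
  proof -
    have gg: "g \<bullet> g = \<rho>\<^sup>2 - m" unfolding m_def by simp
    have "(g \<bullet> Y)\<^sup>2 = (norm g)\<^sup>2 * (Y \<bullet> u)\<^sup>2"
      by (subst u(2)) (simp add: power_mult_distrib inner_commute)
    then have "(g \<bullet> Y)\<^sup>2 = (\<rho>\<^sup>2 - m) * (Y \<bullet> u)\<^sup>2" by (simp add: power2_norm_eq_inner gg)
    then have "\<rho>\<^sup>2 * (Y \<bullet> Y) - (g \<bullet> Y)\<^sup>2 = m * (Y \<bullet> u)\<^sup>2 + \<rho>\<^sup>2 * (Y \<bullet> v)\<^sup>2"
      unfolding inner_self_orthonormal[OF u(1) v, of Y] by algebra
    then show ?thesis using \<rho> m by (auto simp: field_simps)
  qed
  then have "focal_ellipse c g \<rho>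
    = {P. ((P - c) \<bullet> u)\<^sup>2 / \<rho>\<^sup>2 + ((P - c) \<bullet> v)\<^sup>2 / (sqrt m)\<^sup>2 = 1}"
    unfolding focal_ellipse_def m_def[symmetric] using m by simp
  moreover have "0 < sqrt m" using m by simp
  ultimately show ?thesis unfolding ellipse_with_semiaxes_def m_def[symmetric]
    using le u(1) v by blast
qed

text \<open>Two point reflections compose to the translation by \<open>2 *\<^sub>R (c' - c)\<close>,
  whose iterates leave every bounded set unless the centers agree.\<close>

lemma center_of_bounded_unique:
  assumes "centered_at S c" "centered_at S c'" "bounded S" "S \<noteq> {}"
  shows "c = c'"
proof (rule ccontr)
  assume "c \<noteq> c'"
  then have pos: "norm (c' - c) > 0" by simp
  obtain x where x: "x \<in> S" using assms(4) by blast
  obtain b where b: "\<And>y. y \<in> S \<Longrightarrow> norm y \<le> b" using assms(3) unfolding bounded_iff by blast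
  have step: "y + 2 *\<^sub>R (c' - c) \<in> S" if "y \<in> S" for y
  proof -
    have "2 *\<^sub>R c' - (2 *\<^sub>R c - y) \<in> S" using that assms(1,2) unfolding centered_at_def by blast
    then show ?thesis by (simp add: algebra_simps)
  qed
  have translate: "x + real k *\<^sub>R (2 *\<^sub>R (c' - c)) \<in> S" for k
  proof (induction k)
    case (Suc k)
    then show ?case using step[OF Suc] by (simp add: algebra_simps)
  qed (use x in simp)
  obtain k :: nat where "real k * norm (c' - c) > b + norm x"
    using reals_Archimedean3[OF pos] by blast
  moreover have "norm (real k *\<^sub>R (2 *\<^sub>R (c' - c))) \<le> b + norm x"
    using norm_triangle_ineq4[of "x + real k *\<^sub>R (2 *\<^sub>R (c' - c))" x] b[OF translate[of k]] by simp
  moreover have "norm (real k *\<^sub>R (2 *\<^sub>R (c' - c))) = 2 * (real k * norm (c' - c))" by simp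
  moreover have "real k * norm (c' - c) \<ge> 0" by simp
  ultimately show False by linarith
qed

text \<open>The semiaxes become the extreme distances of \<open>S\<close> from its center. Unlike
  the axis directions, which a circle does not determine, these depend on \<open>S\<close> alone, so
  the semiaxes are unique once the center is.\<close>

lemma ellipse_with_semiaxes_extrema:
  assumes "ellipse_with_semiaxes S \<alpha> \<beta>"
  obtains c where "centered_at S c" "\<And>X. X \<in> S \<Longrightarrow> \<beta> \<le> dist X c \<and> dist X c \<le> \<alpha>"
    "\<exists>X\<in>S. dist X c = \<alpha>" "\<exists>X\<in>S. dist X c = \<beta>"
proof -
  obtain c u v where uv: "norm u = 1" "norm v = 1" "u \<bullet> v = 0"
    and S: "S = {P. ((P - c) \<bullet> u)\<^sup>2 / \<alpha>\<^sup>2 + ((P - c) \<bullet> v)\<^sup>2 / \<beta>\<^sup>2 = 1}"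
    and \<beta>: "0 < \<beta>" "\<beta> \<le> \<alpha>"
    using assms unfolding ellipse_with_semiaxes_def by blast
  have \<alpha>: "0 < \<alpha>" using \<beta> by simp
  have uu: "u \<bullet> u = 1" "v \<bullet> v = 1" using uv by (simp_all flip: power2_norm_eq_inner)
  have "centered_at S c" unfolding centered_at_def S
    by (simp only: mem_Collect_eq reflection_diff inner_minus_left power2_minus ball_simps simp_thms)
  moreover have "\<beta> \<le> dist X c \<and> dist X c \<le> \<alpha>" if "X \<in> S" for X
  proof -
    \<comment> \<open>The two terms of the equation are nonnegative weights with sum 1, and the
      squared distance is the corresponding mean of the squared semiaxes.\<close>
    define s t where "s = ((X - c) \<bullet> u)\<^sup>2 / \<alpha>\<^sup>2" and "t = ((X - c) \<bullet> v)\<^sup>2 / \<beta>\<^sup>2"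
    have st: "s + t = 1" "s \<ge> 0" "t \<ge> 0" using that unfolding S s_def t_def by simp_all
    have "(dist X c)\<^sup>2 = s * \<alpha>\<^sup>2 + t * \<beta>\<^sup>2"
      unfolding dist_norm power2_norm_eq_inner inner_self_orthonormal[OF uv, of "X - c"] s_def t_def
      using \<alpha> \<beta> by simp
    moreover have "\<beta>\<^sup>2 \<le> \<alpha>\<^sup>2" using \<beta> by (simp add: power_mono)
    then have "s * \<beta>\<^sup>2 \<le> s * \<alpha>\<^sup>2" "t * \<beta>\<^sup>2 \<le> t * \<alpha>\<^sup>2" using st by (simp_all add: mult_left_mono)
    moreover have "s * \<alpha>\<^sup>2 + t * \<alpha>\<^sup>2 = \<alpha>\<^sup>2" "s * \<beta>\<^sup>2 + t * \<beta>\<^sup>2 = \<beta>\<^sup>2"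
      using st(1) by (simp_all flip: distrib_right)
    ultimately have "\<beta>\<^sup>2 \<le> (dist X c)\<^sup>2" "(dist X c)\<^sup>2 \<le> \<alpha>\<^sup>2" by linarith+
    then show ?thesis using \<alpha> \<beta> by (auto intro: power2_le_imp_le)
  qed
  moreover have "c + \<alpha> *\<^sub>R u \<in> S" "c + \<beta> *\<^sub>R v \<in> S"
    unfolding S using \<alpha> \<beta> uu uv(3) by (simp_all add: inner_commute[of v u])
  moreover have "dist (c + \<alpha> *\<^sub>R u) c = \<alpha>" "dist (c + \<beta> *\<^sub>R v) c = \<beta>"
    using \<alpha> \<beta> uv by (simp_all add: dist_norm)
  ultimately show thesis using that[of c] by blast
qed

lemma ellipse_with_semiaxes_unique:
  assumes "ellipse_with_semiaxes S \<alpha> \<beta>" "ellipse_with_semiaxes S \<alpha>' \<beta>'"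
  shows "\<alpha> = \<alpha>' \<and> \<beta> = \<beta>'"
proof -
  obtain c where c: "centered_at S c" "\<And>X. X \<in> S \<Longrightarrow> \<beta> \<le> dist X c \<and> dist X c \<le> \<alpha>"
    "\<exists>X\<in>S. dist X c = \<alpha>" "\<exists>X\<in>S. dist X c = \<beta>"
    by (rule ellipse_with_semiaxes_extrema[OF assms(1)]) blast
  obtain c' where c': "centered_at S c'" "\<And>X. X \<in> S \<Longrightarrow> \<beta>' \<le> dist X c' \<and> dist X c' \<le> \<alpha>'"
    "\<exists>X\<in>S. dist X c' = \<alpha>'" "\<exists>X\<in>S. dist X c' = \<beta>'"
    by (rule ellipse_with_semiaxes_extrema[OF assms(2)]) blast
  have "bounded S" unfolding bounded_def using c(2) by (metis dist_commute)
  moreover have "S \<noteq> {}" using c(3) by blast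
  ultimately have "c = c'" using center_of_bounded_unique c(1) c'(1) by blast
  then show ?thesis using c(2-4) c'(2-4) by (metis antisym)
qed

lemma semiaxes_eq:
  assumes "ellipse_with_semiaxes S \<alpha> \<beta>"
  shows "major_semiaxis S = \<alpha>" "minor_semiaxis S = \<beta>"
  unfolding major_semiaxis_def minor_semiaxis_def
  using assms ellipse_with_semiaxes_unique by blast+

lemma (in nondegenerate_triangle) macbeath_inconic_excentral_semiaxes:
  "ellipse_with_semiaxes (macbeath_inconic (excentral_triangle (A, B, C)))
     cradius (sqrt (2 * inradius (A, B, C) * cradius))"
proof -
  let ?g = "incenter_pt - ccenter"
  have gg: "?g \<bullet> ?g = cradius\<^sup>2 - 2 * inradius (A, B, C) * cradius"
    using euler_power unfolding two_inradius_circumradius dist_norm power2_norm_eq_inner .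
  then have "(norm ?g)\<^sup>2 < cradius\<^sup>2"
    unfolding power2_norm_eq_inner using inradius_pos circumradius_pos by simp
  then have "norm ?g < cradius" using circumradius_pos by (simp add: power2_less_imp_less)
  from ellipse_with_semiaxes_focal_ellipse[OF this, of ccenter] show ?thesis
    unfolding macbeath_inconic_excentral gg by simp
qed


section \<open>Billiard orbits\<close>

(* W ** L = mat 1 for the matrix W with columns (x i, y i, 1) exhibits the inverse of
   diag (1 - q, 1 + q, p); comparing it with x i ^ 2 + y i ^ 2 = 1 gives the last equation. *)
lemma self_polar_triangle:
  fixes x y :: "3 \<Rightarrow> real" and p q :: real
  defines "d \<equiv> \<lambda>i. (1 - q) * (x i)\<^sup>2 + (1 + q) * (y i)\<^sup>2 + p"
  assumes unit: "\<And>i. (x i)\<^sup>2 + (y i)\<^sup>2 = 1"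
    and polar: "\<And>i j. i \<noteq> j \<Longrightarrow> (1 - q) * x i * x j + (1 + q) * y i * y j + p = 0"
    and nz: "\<And>i. d i \<noteq> 0"
  shows "p * (\<Sum>i\<in>UNIV. 1 / d i) = 1" and "2 * p = 1 - q\<^sup>2"
proof -
  define W :: "real^3^3" where "W = vector [\<chi> i. x i, \<chi> i. y i, \<chi> i. 1]"
  define L :: "real^3^3" where
    "L = (\<chi> i. vector [(1 - q) * x i / d i, (1 + q) * y i / d i, p / d i])"
  have "(L ** W) $ i $ j = (mat 1 :: real^3^3) $ i $ j" for i j
  proof -
    have "(L ** W) $ i $ j = ((1 - q) * x i * x j + (1 + q) * y i * y j + p) / d i"
      by (simp add: L_def W_def matrix_matrix_mult_def sum_3 add_divide_distrib)
    then show ?thesis using polar[of i j] nz[of i]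
      by (auto simp: mat_def d_def power2_eq_square mult.assoc)
  qed
  then have "L ** W = mat 1" by (simp add: vec_eq_iff)
  \<comment> \<open>Rows times columns in \<open>L ** W\<close> pair the vertices with each other;
    in the other order the entries are sums over all vertices.\<close>
  then have WL: "W ** L = mat 1" by (simp add: matrix_left_right_inverse)
  have "(W ** L) $ 1 $ 1 = (1 - q) * (\<Sum>i\<in>UNIV. (x i)\<^sup>2 / d i)"
    "(W ** L) $ 2 $ 2 = (1 + q) * (\<Sum>i\<in>UNIV. (y i)\<^sup>2 / d i)"
    "(W ** L) $ 3 $ 3 = p * (\<Sum>i\<in>UNIV. 1 / d i)"
    by (simp_all add: L_def W_def matrix_matrix_mult_def sum_3 algebra_simps power2_eq_square)
  then have eqs: "(1 - q) * (\<Sum>i\<in>UNIV. (x i)\<^sup>2 / d i) = 1"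
    "(1 + q) * (\<Sum>i\<in>UNIV. (y i)\<^sup>2 / d i) = 1" "p * (\<Sum>i\<in>UNIV. 1 / d i) = 1"
    unfolding WL by (simp_all add: mat_def)
  show "p * (\<Sum>i\<in>UNIV. 1 / d i) = 1" by (rule eqs)
  \<comment> \<open>By the three identities the sums are 1/(1 - q), 1/(1 + q) and 1/p, so the
    relation between \<open>p\<close> and \<open>q\<close> follows by adding the first two.\<close>
  have "(\<Sum>i\<in>UNIV. (x i)\<^sup>2 / d i) + (\<Sum>i\<in>UNIV. (y i)\<^sup>2 / d i) = (\<Sum>i\<in>UNIV. 1 / d i)"
    by (simp add: unit flip: sum.distrib add_divide_distrib)
  with eqs show "2 * p = 1 - q\<^sup>2" by algebra
qed

text \<open>The inner products are the cosines of the angles. Both sides reduce to Heron's product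
  without the perimeter, divided by \<open>2 * BC * CA * AB\<close>: the left by the area formulas
  for r and R, the right by the law of cosines.\<close>

lemma (in nondegenerate_triangle) inradius_div_circumradius:
  "inradius (A, B, C) / cradius = sgn (B - A) \<bullet> sgn (C - A) + sgn (C - B) \<bullet> sgn (A - B)
     + sgn (A - C) \<bullet> sgn (B - C) - 1"
proof -
  interpret BCA: nondegenerate_triangle B C A by (rule rotate)
  interpret CAB: nondegenerate_triangle C A B by (rule BCA.rotate)
  have "inradius (A, B, C) / cradius = 4 * twice_area\<^sup>2 / (perimeter * (2 * BC * CA * AB))"
  proof -
    have "\<bar>t\<bar> / p / (x * y * z / (2 * \<bar>t\<bar>)) = 4 * t\<^sup>2 / (p * (2 * x * y * z))"
      for t p x y z :: real by (simp add: abs_if power2_eq_square mult_ac)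
    then show ?thesis unfolding inradius_eq circumradius_eq .
  qed
  also have "\<dots> = (CA + AB - BC) * (AB + BC - CA) * (BC + CA - AB) / (2 * BC * CA * AB)"
    unfolding heron using perimeter_pos by (simp only: mult.assoc mult_divide_mult_cancel_left_if) simp
  also have "\<dots> = (CA\<^sup>2 + AB\<^sup>2 - BC\<^sup>2) / (2 * CA * AB) + (AB\<^sup>2 + BC\<^sup>2 - CA\<^sup>2) / (2 * AB * BC)
      + (BC\<^sup>2 + CA\<^sup>2 - AB\<^sup>2) / (2 * BC * CA) - 1"
  proof -
    have "(y + z - x) * (z + x - y) * (x + y - z) / (2 * x * y * z)
      = (y\<^sup>2 + z\<^sup>2 - x\<^sup>2) / (2 * y * z) + (z\<^sup>2 + x\<^sup>2 - y\<^sup>2) / (2 * z * x)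
      + (x\<^sup>2 + y\<^sup>2 - z\<^sup>2) / (2 * x * y) - 1"
      if "x > 0" "y > 0" "z > 0" for x y z :: real
      using that by (simp add: field_simps power2_eq_square)
    then show ?thesis using sides_pos by blast
  qed
  also have "(CA\<^sup>2 + AB\<^sup>2 - BC\<^sup>2) / (2 * CA * AB) = sgn (B - A) \<bullet> sgn (C - A)"
    unfolding sgn_edges inner_scaleR_left inner_scaleR_right edge_inner by simp
  also have "(AB\<^sup>2 + BC\<^sup>2 - CA\<^sup>2) / (2 * AB * BC) = sgn (C - B) \<bullet> sgn (A - B)"
    unfolding sgn_edges inner_scaleR_left inner_scaleR_right BCA.edge_inner by simp
  also have "(BC\<^sup>2 + CA\<^sup>2 - AB\<^sup>2) / (2 * BC * CA) = sgn (A - C) \<bullet> sgn (B - C)"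
    unfolding sgn_edges inner_scaleR_left inner_scaleR_right CAB.edge_inner by simp
  finally show ?thesis .
qed

section \<open>Joachimsthal's constant and the self-polar vertices\<close>

definition ellipse_normal :: "real \<Rightarrow> real \<Rightarrow> real^2 \<Rightarrow> real^2" where
  "ellipse_normal a b P = vector [P$1 / a\<^sup>2, P$2 / b\<^sup>2]"

lemma ellipse_normal_inner:
  "ellipse_normal a b P \<bullet> Q = P$1 * Q$1 / a\<^sup>2 + P$2 * Q$2 / b\<^sup>2"
  by (simp add: ellipse_normal_def inner_real2)

locale three_periodic = nondegenerate_triangle A B C for A B C +
  fixes a b :: real
  assumes a: "0 < a" and b: "0 < b"
    and on_ellipse: "A \<in> ellipse a b" "B \<in> ellipse a b" "C \<in> ellipse a b"
    and bisects: "normal_line a b A = internal_bisector A B C"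
      "normal_line a b B = internal_bisector B C A"
      "normal_line a b C = internal_bisector C A B"
begin

lemma rotate_three_periodic: "three_periodic B C A a b"
  using a b on_ellipse bisects rotate by (simp add: three_periodic_def three_periodic_axioms_def)

lemma normal_inner_self: "ellipse_normal a b A \<bullet> A = 1"
  using on_ellipse(1) unfolding ellipse_def ellipse_normal_inner by (simp add: power2_eq_square)

lemma bisector_direction:
  obtains t where "sgn (B - A) + sgn (C - A) = t *\<^sub>R ellipse_normal a b A" "t \<noteq> 0"
proof -
  let ?w = "sgn (B - A) + sgn (C - A)"
  have "A + 1 *\<^sub>R ?w \<in> internal_bisector A B C" unfolding internal_bisector_def by blast
  then obtain t where t: "?w = t *\<^sub>R ellipse_normal a b A"
    unfolding bisects(1)[symmetric] normal_line_def ellipse_normal_def by auto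
  have "cross2 (B - A) ?w = twice_area / CA"
    unfolding sgn_edges cross2_def using sides_pos by (simp add: field_simps)
  also have "\<dots> \<noteq> 0" using twice_area_nonzero sides_pos by simp
  finally have "cross2 (B - A) ?w \<noteq> 0" .
  moreover have "cross2 (B - A) 0 = 0" by (simp add: cross2_def)
  ultimately have "?w \<noteq> 0" by metis
  then show thesis using that[OF t] t by auto
qed

text \<open>Up to sign this is the inner product of the normal vector at \<open>A\<close> with the
  unit vector towards \<open>B\<close>. Written as a quotient over the chord length, it is visibly
  symmetric in \<open>A\<close> and \<open>B\<close>.\<close>

definition "joachimsthal = (1 - ellipse_normal a b A \<bullet> B) / AB"

lemma normal_inner_sgn:
  "ellipse_normal a b A \<bullet> sgn (B - A) = - joachimsthal"
  "ellipse_normal a b A \<bullet> sgn (C - A) = - ((1 - ellipse_normal a b A \<bullet> C) / CA)"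
  unfolding sgn_edges joachimsthal_def inner_scaleR_right inner_diff_right normal_inner_self
  using sides_pos by (simp_all add: field_simps)

text \<open>Sum and difference of two unit vectors are orthogonal, and the sum is a nonzero multiple
  of the normal vector.\<close>

lemma reflection: "ellipse_normal a b A \<bullet> sgn (B - A) = ellipse_normal a b A \<bullet> sgn (C - A)"
proof -
  obtain t where t: "sgn (B - A) + sgn (C - A) = t *\<^sub>R ellipse_normal a b A" "t \<noteq> 0"
    by (rule bisector_direction)
  have "sgn (B - A) \<bullet> sgn (B - A) = 1" "sgn (C - A) \<bullet> sgn (C - A) = 1"
    unfolding sgn_edges inner_scaleR_left inner_scaleR_right edge_inner using sides_pos
    by (simp_all add: power2_eq_square)
  moreover have "(u + v) \<bullet> (u - v) = u \<bullet> u - v \<bullet> v" for u v :: "real^2"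
    by (simp add: algebra_simps inner_commute)
  ultimately have "(sgn (B - A) + sgn (C - A)) \<bullet> (sgn (B - A) - sgn (C - A)) = 0"
    by simp
  then have "ellipse_normal a b A \<bullet> (sgn (B - A) - sgn (C - A)) = 0"
    unfolding t(1) using t(2) by simp
  then show ?thesis by (simp add: inner_diff_right)
qed

text \<open>The quotient is the same from both ends of a chord, and \<open>reflection\<close>
  equates the quotients of the two chords at a vertex; so the constant travels around the
  orbit.\<close>

lemma joachimsthal_rotate: "three_periodic.joachimsthal C A a b = joachimsthal"
proof -
  interpret BCA: three_periodic B C A a b by (rule rotate_three_periodic)
  interpret CAB: three_periodic C A B a b by (rule BCA.rotate_three_periodic)
  have "ellipse_normal a b C \<bullet> A = ellipse_normal a b A \<bullet> C"
    by (simp add: ellipse_normal_inner mult.commute)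
  then show ?thesis using reflection normal_inner_sgn unfolding CAB.joachimsthal_def by simp
qed

text \<open>The sum of the unit vectors is t times the normal vector. Its squared length is 2 + 2
  cos and its product with the normal vector is -2 J; eliminating t gives the identity.\<close>

lemma cos_angle:
  "(1 + sgn (B - A) \<bullet> sgn (C - A)) * (ellipse_normal a b A \<bullet> ellipse_normal a b A)
     = 2 * joachimsthal\<^sup>2"
  "joachimsthal \<noteq> 0" "ellipse_normal a b A \<bullet> ellipse_normal a b A \<noteq> 0"
proof -
  let ?n = "ellipse_normal a b A"
  obtain t where t: "sgn (B - A) + sgn (C - A) = t *\<^sub>R ?n" "t \<noteq> 0"
    by (rule bisector_direction)
  have unit: "sgn (B - A) \<bullet> sgn (B - A) = 1" "sgn (C - A) \<bullet> sgn (C - A) = 1"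
    unfolding sgn_edges inner_scaleR_left inner_scaleR_right edge_inner using sides_pos
    by (simp_all add: power2_eq_square)
  have nw: "?n \<bullet> (sgn (B - A) + sgn (C - A)) = - 2 * joachimsthal"
    unfolding inner_add_right reflection[symmetric] normal_inner_sgn(1) by simp
  then have tn: "t * (?n \<bullet> ?n) = - 2 * joachimsthal" unfolding t(1) by simp
  have "?n \<noteq> 0" using normal_inner_self by auto
  then show n0: "?n \<bullet> ?n \<noteq> 0" by simp
  then show "joachimsthal \<noteq> 0" using tn t(2) by auto
  have "2 + 2 * (sgn (B - A) \<bullet> sgn (C - A))
      = (sgn (B - A) + sgn (C - A)) \<bullet> (sgn (B - A) + sgn (C - A))"
    using unit by (simp add: inner_add_left inner_add_right inner_commute)
  also have "\<dots> = t * (?n \<bullet> (sgn (B - A) + sgn (C - A)))"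
    by (subst t(1)) simp
  finally have "2 + 2 * (sgn (B - A) \<bullet> sgn (C - A)) = t * (- 2 * joachimsthal)"
    unfolding nw .
  then show "(1 + sgn (B - A) \<bullet> sgn (C - A)) * (?n \<bullet> ?n) = 2 * joachimsthal\<^sup>2"
    using tn by algebra
qed

text \<open>Squaring the definition gives
  \<open>joachimsthal\<^sup>2 * AB\<^sup>2 = \<delta>\<^sup>2\<close>. For points of the unit
  circle, \<open>(x - x')\<^sup>2\<close> and \<open>(y - y')\<^sup>2\<close> are both divisible by
  \<delta>, and cancelling it leaves an equation of degree one in each end point.\<close>

lemma chord_conjugate:
  "(1 - joachimsthal\<^sup>2 * (a\<^sup>2 - b\<^sup>2)) * (A$1 / a) * (B$1 / a)
    + (1 + joachimsthal\<^sup>2 * (a\<^sup>2 - b\<^sup>2)) * (A$2 / b) * (B$2 / b)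
    + (joachimsthal\<^sup>2 * (a\<^sup>2 + b\<^sup>2) - 1) = 0"
proof -
  define x y x' y' where "x = A$1 / a" and "y = A$2 / b" and "x' = B$1 / a" and "y' = B$2 / b"
  have unit: "x\<^sup>2 + y\<^sup>2 = 1" "x'\<^sup>2 + y'\<^sup>2 = 1"
    using on_ellipse unfolding ellipse_def x_def y_def x'_def y'_def by (simp_all add: power_divide)
  define \<delta> where "\<delta> = 1 - x * x' - y * y'"
  have "ellipse_normal a b A \<bullet> B = x * x' + y * y'"
    unfolding ellipse_normal_inner x_def y_def x'_def y'_def by (simp add: power2_eq_square)
  then have "joachimsthal * AB = \<delta>" unfolding joachimsthal_def \<delta>_def using sides_pos by simp
  then have j: "joachimsthal\<^sup>2 * AB\<^sup>2 = \<delta>\<^sup>2" by (metis power_mult_distrib)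
  have "AB\<^sup>2 = (A - B) \<bullet> (A - B)" by (simp add: dist_norm power2_norm_eq_inner)
  also have "\<dots> = a\<^sup>2 * (x - x')\<^sup>2 + b\<^sup>2 * (y - y')\<^sup>2"
    unfolding inner_real2 x_def y_def x'_def y'_def using a b
    by (simp add: power2_eq_square field_simps)
  also have "(x - x')\<^sup>2 = \<delta> * (1 - x * x' + y * y')" unfolding \<delta>_def using unit by algebra
  also have "(y - y')\<^sup>2 = \<delta> * (1 + x * x' - y * y')" unfolding \<delta>_def using unit by algebra
  finally have AB2: "AB\<^sup>2 = \<delta> * (a\<^sup>2 * (1 - x * x' + y * y') + b\<^sup>2 * (1 + x * x' - y * y'))"
    by algebra
  then have "\<delta> \<noteq> 0" using sides_pos by auto
  moreover have "\<delta> * (joachimsthal\<^sup>2 * (a\<^sup>2 * (1 - x * x' + y * y') + b\<^sup>2 * (1 + x * x' - y * y')))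
      = \<delta> * \<delta>"
    using j unfolding AB2 by algebra
  ultimately have "joachimsthal\<^sup>2 * (a\<^sup>2 * (1 - x * x' + y * y') + b\<^sup>2 * (1 + x * x' - y * y')) = \<delta>"
    by simp
  then show ?thesis unfolding x_def[symmetric] y_def[symmetric] x'_def[symmetric] y'_def[symmetric]
    unfolding \<delta>_def by algebra
qed

text \<open>The form of \<open>chord_conjugate\<close> evaluated at a single vertex. The value is
  nonzero, and it links the sums over vertices from \<open>self_polar_triangle\<close> to the
  cosines from \<open>cos_angle\<close>.\<close>

lemma diagonal_term:
  "(1 - joachimsthal\<^sup>2 * (a\<^sup>2 - b\<^sup>2)) * (A$1 / a)\<^sup>2
    + (1 + joachimsthal\<^sup>2 * (a\<^sup>2 - b\<^sup>2)) * (A$2 / b)\<^sup>2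
    + (joachimsthal\<^sup>2 * (a\<^sup>2 + b\<^sup>2) - 1)
   = 2 * a\<^sup>2 * b\<^sup>2 * joachimsthal\<^sup>2 * (ellipse_normal a b A \<bullet> ellipse_normal a b A)"
proof -
  define x y where "x = A$1 / a" and "y = A$2 / b"
  have unit: "x\<^sup>2 + y\<^sup>2 = 1"
    using on_ellipse unfolding ellipse_def x_def y_def by (simp add: power_divide)
  have "a\<^sup>2 * b\<^sup>2 * (ellipse_normal a b A \<bullet> ellipse_normal a b A) = b\<^sup>2 * x\<^sup>2 + a\<^sup>2 * y\<^sup>2"
    unfolding inner_real2 ellipse_normal_def x_def y_def using a b
    by (simp add: power2_eq_square field_simps)
  then show ?thesis unfolding x_def[symmetric] y_def[symmetric] using unit by algebra
qed

lemma inradius_div_circumradius_joachimsthal: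
  "(a\<^sup>2 - b\<^sup>2)\<^sup>2 * (joachimsthal\<^sup>2)\<^sup>2 + 2 * (a\<^sup>2 + b\<^sup>2) * joachimsthal\<^sup>2 = 3"
  "inradius (A, B, C) / cradius
    = 4 * a\<^sup>2 * b\<^sup>2 * (joachimsthal\<^sup>2)\<^sup>2 / (joachimsthal\<^sup>2 * (a\<^sup>2 + b\<^sup>2) - 1) - 4"
proof -
  interpret BCA: three_periodic B C A a b by (rule rotate_three_periodic)
  interpret CAB: three_periodic C A B a b by (rule BCA.rotate_three_periodic)
  define J where "J = joachimsthal\<^sup>2"
  have CJ: "CAB.joachimsthal = joachimsthal" by (rule joachimsthal_rotate)
  have BJ: "BCA.joachimsthal = joachimsthal" using CAB.joachimsthal_rotate CJ by simp
  define V :: "3 \<Rightarrow> real^2" where "V i = (if i = 1 then A else if i = 2 then B else C)" for i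
  define x y where "x i = V i $ 1 / a" and "y i = V i $ 2 / b" for i
  define p q where "p = J * (a\<^sup>2 + b\<^sup>2) - 1" and "q = J * (a\<^sup>2 - b\<^sup>2)"
  define d where "d i = (1 - q) * (x i)\<^sup>2 + (1 + q) * (y i)\<^sup>2 + p" for i
  define n where "n i = ellipse_normal a b (V i) \<bullet> ellipse_normal a b (V i)" for i
  have i3: "i = 1 \<or> i = 2 \<or> i = 3" for i :: 3 using exhaust_3 .
  have unit: "(x i)\<^sup>2 + (y i)\<^sup>2 = 1" for i
    using on_ellipse unfolding ellipse_def x_def y_def V_def by (simp add: power_divide)
  have dn: "d i = 2 * a\<^sup>2 * b\<^sup>2 * J * n i" for i
    unfolding d_def n_def x_def y_def V_def p_def q_def J_def
    using diagonal_term BCA.diagonal_term CAB.diagonal_term unfolding CJ BJ by simp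
  have n0: "n i \<noteq> 0" for i
    unfolding n_def V_def using cos_angle(3) BCA.cos_angle(3) CAB.cos_angle(3) by simp
  have J: "J > 0" unfolding J_def using cos_angle(2) by simp
  have d0: "d i \<noteq> 0" for i unfolding dn using n0 J a b by simp
  have polar: "(1 - q) * x i * x j + (1 + q) * y i * y j + p = 0" if "i \<noteq> j" for i j
  proof -
    note c = chord_conjugate BCA.chord_conjugate[unfolded BJ] CAB.chord_conjugate[unfolded CJ]
    have *: "(1 - q) * x 1 * x 2 + (1 + q) * y 1 * y 2 + p = 0"
      "(1 - q) * x 2 * x 3 + (1 + q) * y 2 * y 3 + p = 0"
      "(1 - q) * x 3 * x 1 + (1 + q) * y 3 * y 1 + p = 0"
      using c unfolding x_def y_def V_def p_def q_def J_def by simp_all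
    show ?thesis using i3[of i] i3[of j] that * by (auto simp: mult_ac)
  qed
  note sp = self_polar_triangle[of x y q p, folded d_def, OF unit polar d0]
  have "2 * p = 1 - q\<^sup>2" by (rule sp(2))
  then show "(a\<^sup>2 - b\<^sup>2)\<^sup>2 * (joachimsthal\<^sup>2)\<^sup>2 + 2 * (a\<^sup>2 + b\<^sup>2) * joachimsthal\<^sup>2 = 3"
    unfolding p_def q_def J_def[symmetric] by algebra
  have psum: "p * (\<Sum>i\<in>UNIV. 1 / d i) = 1" by (rule sp(1))
  then have p0: "p \<noteq> 0" by auto
  have dsum: "(\<Sum>i\<in>UNIV. 1 / d i) = 1 / p" using psum p0 by (simp add: eq_divide_eq mult.commute)
  have "(\<Sum>i\<in>UNIV. 1 / n i) = 2 * a\<^sup>2 * b\<^sup>2 * J * (\<Sum>i\<in>UNIV. 1 / d i)"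
    unfolding dn sum_distrib_left using J a b by simp
  then have nsum: "1 / n 1 + 1 / n 2 + 1 / n 3 = 2 * a\<^sup>2 * b\<^sup>2 * J / p"
    unfolding dsum by (simp add: sum_3)
  have cosA: "1 + sgn (B - A) \<bullet> sgn (C - A) = 2 * J * (1 / n 1)"
    using cos_angle(1) n0[of 1] unfolding J_def n_def V_def by (simp add: field_simps)
  have cosB: "1 + sgn (C - B) \<bullet> sgn (A - B) = 2 * J * (1 / n 2)"
    using BCA.cos_angle(1) n0[of 2] unfolding J_def n_def V_def BJ by (simp add: field_simps)
  have cosC: "1 + sgn (A - C) \<bullet> sgn (B - C) = 2 * J * (1 / n 3)"
    using CAB.cos_angle(1) n0[of 3] unfolding J_def n_def V_def CJ by (simp add: field_simps)
  \<comment> \<open>Three of the 4 come from the summands 1 + cos, the last from the sum of the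
    cosines being 1 + r/R.\<close>
  have "inradius (A, B, C) / cradius = 2 * J * (1 / n 1 + 1 / n 2 + 1 / n 3) - 4"
    unfolding inradius_div_circumradius using cosA cosB cosC by (simp add: algebra_simps)
  then show "inradius (A, B, C) / cradius
      = 4 * a\<^sup>2 * b\<^sup>2 * (joachimsthal\<^sup>2)\<^sup>2 / (joachimsthal\<^sup>2 * (a\<^sup>2 + b\<^sup>2) - 1) - 4"
    unfolding nsum p_def[symmetric] J_def[symmetric] by (simp add: power2_eq_square)
qed

end


section \<open>Two isosceles orbits with different circumradii\<close>

lemma line_direction_cong:
  fixes v w :: "'a::real_vector"
  assumes "w = k *\<^sub>R v" "k \<noteq> 0"
  shows "{P + t *\<^sub>R w | t. True} = {P + t *\<^sub>R v | t. True}"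
proof -
  have "\<exists>s. P + t *\<^sub>R w = P + s *\<^sub>R v" "\<exists>s. P + t *\<^sub>R v = P + s *\<^sub>R w" for t
    using assms by (auto intro: exI[of _ "t * k"] exI[of _ "t / k"])
  then show ?thesis by blast
qed

(* The shape of the isosceles orbit: with the Joachimsthal constant J one has
   4 * sigma ^ 2 = 1 / J ^ 2 and q = J ^ 2 * (alpha ^ 2 - beta ^ 2). *)
lemma isosceles_three_periodic:
  fixes e f :: "real^2" and \<alpha> \<beta> \<sigma> q :: real
  assumes orthonormal: "norm e = 1" "norm f = 1" "e \<bullet> f = 0"
    and pos: "0 < \<alpha>" "0 < \<sigma>" "-1 < q" "q < 1"
    and \<alpha>: "\<alpha>\<^sup>2 = \<sigma>\<^sup>2 * (3 - q) * (1 + q)" and \<beta>: "\<beta>\<^sup>2 = \<sigma>\<^sup>2 * (3 + q) * (1 - q)"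
  defines "\<xi> \<equiv> - \<alpha> * (1 + q) / 2" and "\<eta> \<equiv> \<sigma> * (3 + q) * (1 - q) / 2"
  defines "A \<equiv> \<alpha> *\<^sub>R e + 0 *\<^sub>R f" and "B \<equiv> \<xi> *\<^sub>R e + \<eta> *\<^sub>R f" and "C \<equiv> \<xi> *\<^sub>R e + (- \<eta>) *\<^sub>R f"
  shows "nondegenerate (A, B, C)"
    and "circumradius (A, B, C) = \<sigma>\<^sup>2 * (3 + q) / \<alpha>"
    and "internal_bisector A B C = {A + t *\<^sub>R ((\<alpha> / \<alpha>\<^sup>2) *\<^sub>R e + (0 / \<beta>\<^sup>2) *\<^sub>R f) | t. True}"
    and "internal_bisector B C A = {B + t *\<^sub>R ((\<xi> / \<alpha>\<^sup>2) *\<^sub>R e + (\<eta> / \<beta>\<^sup>2) *\<^sub>R f) | t. True}"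
    and "internal_bisector C A B = {C + t *\<^sub>R ((\<xi> / \<alpha>\<^sup>2) *\<^sub>R e + ((- \<eta>) / \<beta>\<^sup>2) *\<^sub>R f) | t. True}"
    and "\<xi>\<^sup>2 / \<alpha>\<^sup>2 + \<eta>\<^sup>2 / \<beta>\<^sup>2 = 1"
proof -
  \<comment> \<open>Altitude from the apex and length of the two equal sides. That
    \<open>h\<^sup>2 + \<eta>\<^sup>2\<close> is a perfect square keeps all unit vectors free of
    roots.\<close>
  define h where "h = \<alpha> * (3 + q) / 2"
  define l where "l = \<sigma> * (3 + q)"
  have l: "l > 0" and h: "h > 0" and \<eta>: "\<eta> > 0" using pos by (simp_all add: l_def h_def \<eta>_def)
  have ee: "e \<bullet> e = 1" "f \<bullet> f = 1" "f \<bullet> e = 0"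
    using orthonormal by (simp_all add: inner_commute flip: power2_norm_eq_inner)
  have norm2: "(norm (x *\<^sub>R e + y *\<^sub>R f))\<^sup>2 = x\<^sup>2 + y\<^sup>2" for x y
    unfolding power2_norm_eq_inner
    by (simp add: inner_add_left inner_add_right ee orthonormal(3) power2_eq_square)
  have AB: "B - A = (- h) *\<^sub>R e + \<eta> *\<^sub>R f" and AC: "C - A = (- h) *\<^sub>R e + (- \<eta>) *\<^sub>R f"
    and BA: "A - B = h *\<^sub>R e + (- \<eta>) *\<^sub>R f" and CA: "A - C = h *\<^sub>R e + \<eta> *\<^sub>R f"
    and BC: "C - B = 0 *\<^sub>R e + (- 2 * \<eta>) *\<^sub>R f" and CB: "B - C = 0 *\<^sub>R e + (2 * \<eta>) *\<^sub>R f"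
    unfolding A_def B_def C_def h_def \<xi>_def eq_real2_iff by (simp_all add: field_simps)
  have hl: "h\<^sup>2 + \<eta>\<^sup>2 = l\<^sup>2"
  proof -
    have "4 * (h\<^sup>2 + \<eta>\<^sup>2) = \<alpha>\<^sup>2 * (3 + q)\<^sup>2 + (\<sigma> * (3 + q) * (1 - q))\<^sup>2"
      unfolding h_def \<eta>_def by (simp add: power_divide power_mult_distrib)
    also have "\<dots> = 4 * l\<^sup>2" unfolding \<alpha> l_def by algebra
    finally show ?thesis by simp
  qed
  have norm: "norm (x *\<^sub>R e + y *\<^sub>R f) = r" if "x\<^sup>2 + y\<^sup>2 = r\<^sup>2" "r > 0" for x y r
    using norm2[of x y] that by (metis norm_ge_zero power2_eq_iff_nonneg less_imp_le)
  have sgn: "sgn (x *\<^sub>R e + y *\<^sub>R f) = (x / r) *\<^sub>R e + (y / r) *\<^sub>R f" if "x\<^sup>2 + y\<^sup>2 = r\<^sup>2" "r > 0" for x y r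
    unfolding sgn_div_norm norm[OF that] by (simp add: scaleR_add_right divide_inverse mult.commute)
  have sAB: "sgn (B - A) = (- h / l) *\<^sub>R e + (\<eta> / l) *\<^sub>R f" "sgn (C - A) = (- h / l) *\<^sub>R e + (- \<eta> / l) *\<^sub>R f"
    "sgn (A - B) = (h / l) *\<^sub>R e + (- \<eta> / l) *\<^sub>R f" "sgn (A - C) = (h / l) *\<^sub>R e + (\<eta> / l) *\<^sub>R f"
    unfolding AB AC BA CA by (rule sgn; use hl l in simp)+
  have sBC: "sgn (C - B) = (0 / (2 * \<eta>)) *\<^sub>R e + (- 2 * \<eta> / (2 * \<eta>)) *\<^sub>R f"
    "sgn (B - C) = (0 / (2 * \<eta>)) *\<^sub>R e + (2 * \<eta> / (2 * \<eta>)) *\<^sub>R f"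
    unfolding BC CB by (rule sgn; use \<eta> in simp)+
  have cross: "cross2 (B - A) (C - A) = 2 * h * \<eta> * cross2 e f"
    unfolding AB AC by (simp add: cross2_def algebra_simps)
  have "(cross2 e f)\<^sup>2 = 1" unfolding cross2_squared ee orthonormal(3) by simp
  then have abs: "\<bar>cross2 e f\<bar> = 1" by (auto simp: power2_eq_1_iff)
  show nd: "nondegenerate (A, B, C)"
    unfolding nondegenerate_iff_cross2 cross using h \<eta> abs by auto
  interpret nondegenerate_triangle A B C by unfold_locales (rule nd)
  have "dist A B = l" unfolding dist_norm BA by (rule norm) (use hl l in simp_all)
  moreover have "dist C A = l" unfolding dist_norm AC by (rule norm) (use hl l in simp_all)
  moreover have "dist B C = 2 * \<eta>" unfolding dist_norm CB by (rule norm) (use \<eta> in simp_all)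
  ultimately have "circumradius (A, B, C) = l\<^sup>2 / (2 * h)"
    unfolding circumradius_eq cross abs_mult abs using h \<eta> by (simp add: power2_eq_square)
  also have "\<dots> = \<sigma>\<^sup>2 * (3 + q) / \<alpha>"
    unfolding l_def h_def using pos by (simp add: power2_eq_square)
  finally show "circumradius (A, B, C) = \<sigma>\<^sup>2 * (3 + q) / \<alpha>" .
  have \<xi>\<alpha>: "\<xi> / \<alpha>\<^sup>2 = - (1 + q) / (2 * \<alpha>)" unfolding \<xi>_def using pos by (simp add: power2_eq_square field_simps)
  have \<eta>\<beta>: "\<eta> / \<beta>\<^sup>2 = 1 / (2 * \<sigma>)" unfolding \<eta>_def \<beta> using pos by (simp add: power2_eq_square)
  have hl': "h / l = \<alpha> / (2 * \<sigma>)" "\<eta> / l = (1 - q) / 2"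
    unfolding h_def l_def \<eta>_def using pos by simp_all
  \<comment> \<open>\<open>coeff\<close> and \<open>coeff'\<close> produce the same factor in both
    coordinates, which is what makes the bisector at \<open>B\<close> a normal; the vertex
    \<open>C\<close> is its mirror image.\<close>
  have coeff: "h / l = - (\<sigma> * (3 - q)) * (\<xi> / \<alpha>\<^sup>2)" 
  proof -
    have "\<alpha> * \<alpha> = \<sigma> * (3 - q) * (1 + q) * \<sigma>" using \<alpha> by (simp add: power2_eq_square mult_ac)
    then show ?thesis unfolding hl' \<xi>\<alpha> using pos by (simp add: divide_simps) (simp add: algebra_simps)
  qed
  have coeff': "1 + \<eta> / l = \<sigma> * (3 - q) * (\<eta> / \<beta>\<^sup>2)"
    unfolding hl' \<eta>\<beta> using pos by (simp add: field_simps)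
  have nz: "- (\<sigma> * (3 - q)) \<noteq> 0" using pos by simp
  show "internal_bisector A B C = {A + t *\<^sub>R ((\<alpha> / \<alpha>\<^sup>2) *\<^sub>R e + (0 / \<beta>\<^sup>2) *\<^sub>R f) | t. True}"
    unfolding internal_bisector_def
  proof (rule line_direction_cong)
    show "sgn (B - A) + sgn (C - A) = (- 2 * (h / l) * \<alpha>) *\<^sub>R ((\<alpha> / \<alpha>\<^sup>2) *\<^sub>R e + (0 / \<beta>\<^sup>2) *\<^sub>R f)"
      unfolding sAB eq_real2_iff using pos by (simp add: power2_eq_square)
    show "- 2 * (h / l) * \<alpha> \<noteq> 0" using h l pos by simp
  qed
  show "internal_bisector B C A = {B + t *\<^sub>R ((\<xi> / \<alpha>\<^sup>2) *\<^sub>R e + (\<eta> / \<beta>\<^sup>2) *\<^sub>R f) | t. True}"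
    unfolding internal_bisector_def
  proof (rule line_direction_cong[OF _ nz])
    have "sgn (C - B) + sgn (A - B) = (h / l) *\<^sub>R e + (- (1 + \<eta> / l)) *\<^sub>R f"
      unfolding sAB sBC using \<eta> by (simp add: algebra_simps)
    then show "sgn (C - B) + sgn (A - B)
        = (- (\<sigma> * (3 - q))) *\<^sub>R ((\<xi> / \<alpha>\<^sup>2) *\<^sub>R e + (\<eta> / \<beta>\<^sup>2) *\<^sub>R f)"
      unfolding coeff coeff' by (simp add: scaleR_add_right)
  qed
  show "internal_bisector C A B = {C + t *\<^sub>R ((\<xi> / \<alpha>\<^sup>2) *\<^sub>R e + ((- \<eta>) / \<beta>\<^sup>2) *\<^sub>R f) | t. True}"
    unfolding internal_bisector_def
  proof (rule line_direction_cong[OF _ nz])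
    have "sgn (A - C) + sgn (B - C) = (h / l) *\<^sub>R e + (1 + \<eta> / l) *\<^sub>R f"
      unfolding sAB sBC using \<eta> by (simp add: algebra_simps)
    then show "sgn (A - C) + sgn (B - C)
        = (- (\<sigma> * (3 - q))) *\<^sub>R ((\<xi> / \<alpha>\<^sup>2) *\<^sub>R e + ((- \<eta>) / \<beta>\<^sup>2) *\<^sub>R f)"
      unfolding coeff coeff' by (simp add: scaleR_add_right scaleR_diff_right)
  qed
  have "\<xi>\<^sup>2 / \<alpha>\<^sup>2 = (1 + q)\<^sup>2 / 4" unfolding \<xi>_def using pos by (simp add: power_divide power_mult_distrib)
  moreover have "\<eta>\<^sup>2 / \<beta>\<^sup>2 = (3 + q) * (1 - q) / 4"
    unfolding \<eta>_def \<beta> using pos by (simp add: power2_eq_square)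
  moreover have "(1 + q)\<^sup>2 / 4 + (3 + q) * (1 - q) / 4 = 1"
    by (simp add: power2_eq_square field_simps)
  ultimately show "\<xi>\<^sup>2 / \<alpha>\<^sup>2 + \<eta>\<^sup>2 / \<beta>\<^sup>2 = 1" by (simp only:)
qed

text \<open>Here \<open>q\<close> is the positive root of
  \<open>q\<^sup>2 + 2 * \<kappa> * q = 3\<close>, which is the relation
  \<open>2 * p = 1 - q\<^sup>2\<close> of a self-polar triangle with
  \<open>p = \<kappa> * q - 1\<close>. The bound \<open>q < 1\<close> amounts to \<kappa> > 1, and
  \<sigma> is then fixed by \<open>a\<close>.\<close>

lemma semiaxes_parametrization:
  fixes a b :: real
  assumes "0 < b" "b < a"
  obtains q \<sigma> where "0 < q" "q < 1" "0 < \<sigma>"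
    "a\<^sup>2 = \<sigma>\<^sup>2 * (3 - q) * (1 + q)" "b\<^sup>2 = \<sigma>\<^sup>2 * (3 + q) * (1 - q)"
proof -
  have ab: "b\<^sup>2 < a\<^sup>2" "0 < a" "0 < b\<^sup>2" using assms by (simp_all add: power_strict_mono)
  define \<kappa> where "\<kappa> = (a\<^sup>2 + b\<^sup>2) / (a\<^sup>2 - b\<^sup>2)"
  have \<kappa>: "\<kappa> * (a\<^sup>2 - b\<^sup>2) = a\<^sup>2 + b\<^sup>2" "1 < \<kappa>" unfolding \<kappa>_def using ab by (simp_all add: field_simps)
  define q where "q = sqrt (\<kappa>\<^sup>2 + 3) - \<kappa>"
  have "(q + \<kappa>)\<^sup>2 = \<kappa>\<^sup>2 + 3" unfolding q_def by simp
  then have q: "q\<^sup>2 + 2 * \<kappa> * q = 3" by algebra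
  have q0: "0 < q" unfolding q_def using \<kappa>(2) by (simp add: real_less_rsqrt)
  have "sqrt (\<kappa>\<^sup>2 + 3) < 1 + \<kappa>"
    using \<kappa>(2) by (intro real_less_lsqrt) (auto simp: power2_eq_square algebra_simps)
  then have q1: "q < 1" unfolding q_def by simp
  define \<sigma> where "\<sigma> = a / sqrt ((3 - q) * (1 + q))"
  have pp: "(3 - q) * (1 + q) > 0" using q0 q1 by simp
  have "(a / sqrt x)\<^sup>2 * x = a\<^sup>2" if "x > 0" for x using that by (simp add: power_divide)
  then have "\<sigma>\<^sup>2 * ((3 - q) * (1 + q)) = a\<^sup>2" unfolding \<sigma>_def using pp by blast
  then have s: "a\<^sup>2 = \<sigma>\<^sup>2 * (3 - q) * (1 + q)" by (simp add: mult.assoc)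
  have "a\<^sup>2 * ((3 + q) * (1 - q)) - b\<^sup>2 * ((3 - q) * (1 + q)) = (a\<^sup>2 - b\<^sup>2) * (3 - q\<^sup>2) - 2 * q * (a\<^sup>2 + b\<^sup>2)"
    by (simp add: algebra_simps power2_eq_square)
  also have "\<dots> = (a\<^sup>2 - b\<^sup>2) * (3 - (q\<^sup>2 + 2 * \<kappa> * q))"
    unfolding \<kappa>(1)[symmetric] by (simp add: algebra_simps)
  finally have "a\<^sup>2 * ((3 + q) * (1 - q)) = b\<^sup>2 * ((3 - q) * (1 + q))" unfolding q by simp
  then have "(3 - q) * (1 + q) * b\<^sup>2 = (3 - q) * (1 + q) * (\<sigma>\<^sup>2 * (3 + q) * (1 - q))"
    unfolding s by (auto simp: mult_ac)
  moreover have "(3 - q) * (1 + q) \<noteq> 0" using pp by linarith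
  ultimately have "b\<^sup>2 = \<sigma>\<^sup>2 * (3 + q) * (1 - q)" by (simp only: mult_cancel_left simp_thms)
  moreover have "0 < \<sigma>" unfolding \<sigma>_def using pp ab by simp
  ultimately show thesis using that q0 q1 s by blast
qed

lemma three_periodics_circumradius_not_constant:
  fixes a b :: real
  assumes "0 < b" "b < a"
  obtains T T' where "T \<in> three_periodics a b" "T' \<in> three_periodics a b"
    "circumradius T \<noteq> circumradius T'"
proof -
  obtain q \<sigma> where q: "0 < q" "q < 1" "0 < \<sigma>"
    and ab: "a\<^sup>2 = \<sigma>\<^sup>2 * (3 - q) * (1 + q)" "b\<^sup>2 = \<sigma>\<^sup>2 * (3 + q) * (1 - q)"
    by (rule semiaxes_parametrization[OF assms])
  have a: "0 < a" using assms by simp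
  define e f :: "real^2" where "e = axis 1 1" and "f = axis 2 1"
  have ef: "norm e = 1" "norm f = 1" "e \<bullet> f = 0" "f \<bullet> e = 0"
    by (simp_all add: e_def f_def inner_axis_axis)
  have comp: "(x *\<^sub>R e + y *\<^sub>R f)$1 = x" "(x *\<^sub>R e + y *\<^sub>R f)$2 = y"
    "(y *\<^sub>R f + x *\<^sub>R e)$1 = x" "(y *\<^sub>R f + x *\<^sub>R e)$2 = y" for x y
    by (simp_all add: e_def f_def axis_def)
  have vec: "vector [x, y] = x *\<^sub>R e + y *\<^sub>R f" "vector [x, y] = y *\<^sub>R f + x *\<^sub>R e" for x y :: real
    by (simp_all add: e_def f_def axis_def eq_real2_iff)
  have normal: "normal_line a b (x *\<^sub>R e + y *\<^sub>R f)
      = {x *\<^sub>R e + y *\<^sub>R f + t *\<^sub>R ((x / a\<^sup>2) *\<^sub>R e + (y / b\<^sup>2) *\<^sub>R f) | t. True}" for x y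
    unfolding normal_line_def comp vec(1) ..
  have normal': "normal_line a b (y *\<^sub>R f + x *\<^sub>R e)
      = {y *\<^sub>R f + x *\<^sub>R e + t *\<^sub>R ((y / b\<^sup>2) *\<^sub>R f + (x / a\<^sup>2) *\<^sub>R e) | t. True}" for x y
    unfolding normal_line_def comp vec(2) ..
  have on: "x *\<^sub>R e + y *\<^sub>R f \<in> ellipse a b \<longleftrightarrow> x\<^sup>2 / a\<^sup>2 + y\<^sup>2 / b\<^sup>2 = 1"
    "y *\<^sub>R f + x *\<^sub>R e \<in> ellipse a b \<longleftrightarrow> y\<^sup>2 / b\<^sup>2 + x\<^sup>2 / a\<^sup>2 = 1" for x y
    unfolding ellipse_def mem_Collect_eq comp by (simp_all add: add.commute)
  have q': "-1 < q" "- 1 < - q" "- q < 1" using q by simp_all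
  \<comment> \<open>Exchanging the two axes keeps \<sigma> and changes the sign of \<open>q\<close>,
    so one construction serves both orbits.\<close>
  have ab': "b\<^sup>2 = \<sigma>\<^sup>2 * (3 - (- q)) * (1 + (- q))" "a\<^sup>2 = \<sigma>\<^sup>2 * (3 + (- q)) * (1 - (- q))"
    using ab by simp_all
  note iso = isosceles_three_periodic[OF ef(1-3) a q(3) q'(1) q(2) ab]
  note iso' = isosceles_three_periodic[OF ef(2,1,4) assms(1) q(3) q'(2,3) ab']
  define \<xi> \<eta> \<xi>' \<eta>' where "\<xi> = - a * (1 + q) / 2" and "\<eta> = \<sigma> * (3 + q) * (1 - q) / 2"
    and "\<xi>' = - b * (1 + (- q)) / 2" and "\<eta>' = \<sigma> * (3 + (- q)) * (1 - (- q)) / 2"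
  note iso = iso[folded \<xi>_def \<eta>_def] and iso' = iso'[folded \<xi>'_def \<eta>'_def]
  let ?T = "(a *\<^sub>R e + 0 *\<^sub>R f, \<xi> *\<^sub>R e + \<eta> *\<^sub>R f, \<xi> *\<^sub>R e + (- \<eta>) *\<^sub>R f)"
  let ?T' = "(b *\<^sub>R f + 0 *\<^sub>R e, \<xi>' *\<^sub>R f + \<eta>' *\<^sub>R e, \<xi>' *\<^sub>R f + (- \<eta>') *\<^sub>R e)"
  have T: "?T \<in> three_periodics a b"
    unfolding three_periodics_def mem_Collect_eq prod.case normal on
    using iso(1,3-6) assms by simp
  have T': "?T' \<in> three_periodics a b"
    unfolding three_periodics_def mem_Collect_eq prod.case normal' on
    using iso'(1,3-6) assms by simp
  have "\<sigma>\<^sup>2 * (3 + q) / a \<noteq> \<sigma>\<^sup>2 * (3 + (- q)) / b"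
  proof
    assume "\<sigma>\<^sup>2 * (3 + q) / a = \<sigma>\<^sup>2 * (3 + (- q)) / b"
    then have "\<sigma>\<^sup>2 * (b * (3 + q)) = \<sigma>\<^sup>2 * (a * (3 - q))" using assms by (simp add: field_simps)
    then have "b * (3 + q) = a * (3 - q)" using q by simp
    then have "b\<^sup>2 * (3 + q)\<^sup>2 = a\<^sup>2 * (3 - q)\<^sup>2" by (metis power_mult_distrib)
    \<comment> \<open>In (3 + q)^3 (1 - q) - (3 - q)^3 (1 + q) everything except -16 q^3
      cancels.\<close>
    then have "\<sigma>\<^sup>2 * (q ^ 3) = 0" unfolding ab by algebra
    then show False using q by simp
  qed
  then have "circumradius ?T \<noteq> circumradius ?T'" unfolding iso(2) iso'(2) .
  then show thesis using that T T' by blast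
qed

section \<open>Invariance of r/R and the semiaxes over the family\<close>

lemma three_periodicI:
  assumes "0 < a" "0 < b" "(A, B, C) \<in> three_periodics a b"
  shows "three_periodic A B C a b"
  using assms unfolding three_periodics_def three_periodic_def three_periodic_axioms_def
    nondegenerate_triangle_def by simp

lemma three_periodics_ratio_constant:
  fixes a b :: real
  assumes "0 < a" "0 < b" "T \<in> three_periodics a b" "T' \<in> three_periodics a b"
  shows "inradius T / circumradius T = inradius T' / circumradius T'"
proof -
  obtain A B C A' B' C' where T: "T = (A, B, C)" "T' = (A', B', C')" by (metis surj_pair)
  interpret P: three_periodic A B C a b using assms T by (intro three_periodicI) auto
  interpret P': three_periodic A' B' C' a b using assms T by (intro three_periodicI) auto
  define J J' where "J = P.joachimsthal\<^sup>2" and "J' = P'.joachimsthal\<^sup>2"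
  have pos: "J > 0" "J' > 0" unfolding J_def J'_def using P.cos_angle(2) P'.cos_angle(2) by auto
  have root: "(a\<^sup>2 - b\<^sup>2)\<^sup>2 * J\<^sup>2 + 2 * (a\<^sup>2 + b\<^sup>2) * J = 3" "(a\<^sup>2 - b\<^sup>2)\<^sup>2 * J'\<^sup>2 + 2 * (a\<^sup>2 + b\<^sup>2) * J' = 3"
    unfolding J_def J'_def
    by (rule P.inradius_div_circumradius_joachimsthal P'.inradius_div_circumradius_joachimsthal)+
  have expand: "(J - J') * (u * (J + J') + v) = (u * J\<^sup>2 + v * J) - (u * J'\<^sup>2 + v * J')" for u v
    by (simp add: algebra_simps power2_eq_square)
  \<comment> \<open>The difference of the two quadratic equations factors; the cofactor of
    \<open>J - J'\<close> is positive because both roots are.\<close>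
  have "(J - J') * ((a\<^sup>2 - b\<^sup>2)\<^sup>2 * (J + J') + 2 * (a\<^sup>2 + b\<^sup>2)) = 0"
    unfolding expand root by simp
  moreover have "(a\<^sup>2 - b\<^sup>2)\<^sup>2 * (J + J') + 2 * (a\<^sup>2 + b\<^sup>2) > 0"
    using pos assms(1,2) by (intro add_nonneg_pos mult_pos_pos add_pos_pos mult_nonneg_nonneg) auto
  ultimately have "J = J'" by simp
  then show ?thesis
    unfolding T P.inradius_div_circumradius_joachimsthal(2) P'.inradius_div_circumradius_joachimsthal(2)
    unfolding J_def J'_def by simp
qed

theorem theorem4:
  fixes a b :: real
  assumes "0 < b" and "b < a"
  shows "let I = (\<lambda>T. macbeath_inconic (excentral_triangle T));
             \<mu>' = (\<lambda>T. major_semiaxis (I T));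
             \<mu> = (\<lambda>T. minor_semiaxis (I T))
         in (\<forall>T \<in> three_periodics a b. is_ellipse (I T))
          \<and> \<not> (\<exists>k. \<forall>T \<in> three_periodics a b. \<mu>' T = k)
          \<and> \<not> (\<exists>k. \<forall>T \<in> three_periodics a b. \<mu> T = k)
          \<and> (\<exists>k. \<forall>T \<in> three_periodics a b. \<mu>' T / \<mu> T = k)
          \<and> (\<forall>T \<in> three_periodics a b.
               let r = inradius T; R = circumradius T; \<rho> = r / R; d = sqrt (R * (R - 2 * r))
               in \<mu>' T = R
                \<and> \<mu> T = sqrt (R\<^sup>2 - d\<^sup>2)
                \<and> \<mu>' T / \<mu> T = R / sqrt (R\<^sup>2 - d\<^sup>2)
                \<and> R / sqrt (R\<^sup>2 - d\<^sup>2) = 1 / sqrt (2 * \<rho>))"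
proof -
  let ?I = "\<lambda>T. macbeath_inconic (excentral_triangle T)" and ?P = "three_periodics a b"
  let ?r = inradius and ?R = circumradius
  have a: "0 < a" using assms by simp
  have main: "ellipse_with_semiaxes (?I T) (?R T) (sqrt (2 * ?r T * ?R T))
      \<and> 0 < ?r T \<and> 0 < ?R T \<and> 2 * ?r T \<le> ?R T" if T: "T \<in> ?P" for T
  proof -
    obtain A B C where ABC: "T = (A, B, C)" by (metis surj_pair)
    interpret three_periodic A B C a b using three_periodicI[OF a assms(1)] T ABC by simp
    \<comment> \<open>Euler's inequality 2 r \<le> R. The square of \<open>sqrt x\<close> is the
      absolute value of \<open>x\<close>, so the sign of the radicand matters when
      \<open>d\<^sup>2\<close> is simplified.\<close>
    have "cradius * (cradius - 2 * inradius (A, B, C)) = (dist incenter_pt ccenter)\<^sup>2"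
      unfolding euler_power two_inradius_circumradius[symmetric]
      by (simp add: power2_eq_square algebra_simps)
    then have "0 \<le> cradius * (cradius - 2 * inradius (A, B, C))" by simp
    then show ?thesis unfolding ABC
      using macbeath_inconic_excentral_semiaxes inradius_pos circumradius_pos
      by (simp add: zero_le_mult_iff)
  qed
  have axes: "major_semiaxis (?I T) = ?R T" "minor_semiaxis (?I T) = sqrt (2 * ?r T * ?R T)"
    if "T \<in> ?P" for T using semiaxes_eq main[OF that] by blast+
  have ratio: "?R T / sqrt (2 * ?r T * ?R T) = 1 / sqrt (2 * (?r T / ?R T))" if "T \<in> ?P" for T
  proof -
    have R: "?R T > 0" using main[OF that] by simp
    then have "2 * ?r T * ?R T = (?R T)\<^sup>2 * (2 * (?r T / ?R T))" by (simp add: power2_eq_square)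
    then have "sqrt (2 * ?r T * ?R T) = ?R T * sqrt (2 * (?r T / ?R T))"
      using R by (simp only: real_sqrt_mult) simp
    then show ?thesis using R by simp
  qed
  have d: "(?R T)\<^sup>2 - (sqrt (?R T * (?R T - 2 * ?r T)))\<^sup>2 = 2 * ?r T * ?R T" if "T \<in> ?P" for T
    using main[OF that] by (simp add: power2_eq_square algebra_simps)
  obtain T1 T2 where T12: "T1 \<in> ?P" "T2 \<in> ?P" "?R T1 \<noteq> ?R T2"
    by (rule three_periodics_circumradius_not_constant[OF assms])
  \<comment> \<open>\<open>T1\<close> serves as the reference orbit whose value of r/R supplies the
    constant.\<close>
  have \<rho>: "?r T / ?R T = ?r T1 / ?R T1" if "T \<in> ?P" for T
    using three_periodics_ratio_constant[OF a assms(1) that T12(1)] .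
  have quot: "?R T / sqrt (2 * ?r T * ?R T) = 1 / sqrt (2 * (?r T1 / ?R T1))" if "T \<in> ?P" for T
    unfolding ratio[OF that] \<rho>[OF that] ..
  have pos: "sqrt (2 * ?r T * ?R T) > 0" if "T \<in> ?P" for T using main[OF that] by simp
  \<comment> \<open>Equal minor semiaxes together with the constant quotient would give equal
    circumradii.\<close>
  have "sqrt (2 * ?r T1 * ?R T1) \<noteq> sqrt (2 * ?r T2 * ?R T2)"
  proof
    assume *: "sqrt (2 * ?r T1 * ?R T1) = sqrt (2 * ?r T2 * ?R T2)"
    have "?R T1 / sqrt (2 * ?r T1 * ?R T1) = ?R T2 / sqrt (2 * ?r T2 * ?R T2)"
      unfolding quot[OF T12(1)] quot[OF T12(2)] ..
    moreover have "sqrt (2 * ?r T2 * ?R T2) \<noteq> 0" using pos[OF T12(2)] by linarith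
    ultimately show False using T12(3) unfolding * by (metis divide_cancel_right)
  qed
  then have "\<not> (\<exists>k. \<forall>T\<in>?P. minor_semiaxis (?I T) = k)" using axes(2) T12(1,2) by metis
  moreover have "\<not> (\<exists>k. \<forall>T\<in>?P. major_semiaxis (?I T) = k)" using axes(1) T12 by metis
  moreover have "\<exists>k. \<forall>T\<in>?P. major_semiaxis (?I T) / minor_semiaxis (?I T) = k"
    using axes quot by simp
  moreover have "\<forall>T\<in>?P. is_ellipse (?I T)" unfolding is_ellipse_def using main by blast
  ultimately show ?thesis unfolding Let_def using axes ratio d by simp
qed

end
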